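(* Let $I\subseteq\mathbb{R}$ be an interval and let $f:I\to\mathbb{R}$ be a continuous matrix convex (operator convex) function. For commuting strictly positive $n\times n$ matrices $L,R$ such that the spectrum of $\frac{L}{R}:=LR^{-1}$ lies in $I$, define the perspective function $$g(L,R)=f\left(\frac{L}{R}\right)R .$$ Then $g$ is jointly convex in the following sense. Let $n\in\mathbb{N}$, let $0\le c\le 1$, and let $L_1,L_2,R_1,R_2$ be strictly positive $n\times n$ matrices with $[L_j,R_j]=0$ and with the spectrum of $\frac{L_j}{R_j}$ contained in $I$ for $j=1,2$. Put $L=cL_1+(1-c)L_2$ and $R=cR_1+(1-c)R_2$, and suppose that $[L,R]=0$. Then $$g(L,R)\le c\,g(L_1,R_1)+(1-c)\,g(L_2,R_2).$$
   Context: All matrices are finite complex $n\times n$ matrices. $[L,R]=LR-RL$. A strictly positive matrix ($L>0$) is a self-adjoint positive definite matrix. For self-adjoint $X,Y$, $X\le Y$ means that $Y-X$ is positive semidefinite. For a continuous $f:I\to\mathbb{R}$ on an interval $I$ and a self-adjoint matrix $T$ with spectrum in $I$, $f(T)$ is defined by the spectral functional calculus. The function $f$ is called matrix convex (equivalently, operator convex) if for every $n\in\mathbb{N}$ the map $T\mapsto f(T)$ is convex on the self-adjoint $n\times n$ matrices with spectrum in $I$, i.e. $f(cT_1+(1-c)T_2)\le c f(T_1)+(1-c)f(T_2)$ for $0\le c\le 1$. If $L,R>0$ commute, then $\frac{L}{R}=LR^{-1}=R^{-1}L$ is strictly positive, and $f\left(\frac{L}{R}\right)$ commutes with $R$, so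 $g(L,R)$ is self-adjoint. *)

theory Defs
  imports
    "HOL-Analysis.Topology_Euclidean_Space"
    "Jordan_Normal_Form.Gauss_Jordan_Elimination"
    "Jordan_Normal_Form.Spectral_Radius"
begin

definition hermitian :: "complex mat \<Rightarrow> bool" where
  "hermitian A \<longleftrightarrow> mat_adjoint A = A"

definition unitary :: "complex mat \<Rightarrow> bool" where
  "unitary U \<longleftrightarrow> U \<in> carrier_mat (dim_row U) (dim_row U)
     \<and> mat_adjoint U * U = 1\<^sub>m (dim_row U) \<and> U * mat_adjoint U = 1\<^sub>m (dim_row U)"

definition pos_semidef :: "complex mat \<Rightarrow> bool" where
  "pos_semidef A \<longleftrightarrow> hermitian A \<and> (\<forall>v \<in> carrier_vec (dim_row A). Re ((A *\<^sub>v v) \<bullet>c v) \<ge> 0)"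

definition strictly_pos :: "complex mat \<Rightarrow> bool" where
  "strictly_pos A \<longleftrightarrow> hermitian A
     \<and> (\<forall>v \<in> carrier_vec (dim_row A). v \<noteq> 0\<^sub>v (dim_row A) \<longrightarrow> Re ((A *\<^sub>v v) \<bullet>c v) > 0)"

text \<open>The order is only meant for self-adjoint matrices of the same size, so this is
  part of the relation.\<close>
definition loewner_le :: "complex mat \<Rightarrow> complex mat \<Rightarrow> bool" where
  "loewner_le X Y \<longleftrightarrow> hermitian X \<and> hermitian Y \<and> dim_row X = dim_row Y \<and> pos_semidef (Y - X)"

definition spectrum_in :: "complex mat \<Rightarrow> real set \<Rightarrow> bool" where
  "spectrum_in T I \<longleftrightarrow> spectrum T \<subseteq> complex_of_real ` I"

definition real_diag :: "nat \<Rightarrow> (nat \<Rightarrow> real) \<Rightarrow> complex mat" where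
  "real_diag n d = mat_diag n (\<lambda>i. complex_of_real (d i))"

text \<open>Spectral functional calculus: \<open>f(U diag(d) U\<^sup>*) = U diag(f \<circ> d) U\<^sup>*\<close> for unitary \<open>U\<close>
  and real \<open>d\<close>. Every self-adjoint matrix has such a diagonalization by the spectral
  theorem, and the result does not depend on its choice, see \<open>mat_fun_eq\<close> below.\<close>
definition mat_fun :: "(real \<Rightarrow> real) \<Rightarrow> complex mat \<Rightarrow> complex mat" where
  "mat_fun f T = (THE A. \<exists>U d. unitary U \<and> dim_row U = dim_row T
     \<and> T = U * real_diag (dim_row T) d * mat_adjoint U
     \<and> A = U * real_diag (dim_row T) (\<lambda>i. f (d i)) * mat_adjoint U)"

lemma mat_adjoint_carrier:
  "U \<in> carrier_mat n m \<Longrightarrow> mat_adjoint (U :: complex mat) \<in> carrier_mat m n"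
  by (intro carrier_matI) (simp_all add: mat_adjoint_def)

lemma real_diag_carrier: "real_diag n d \<in> carrier_mat n n"
  by (simp add: real_diag_def)

lemma mat_fun_eq:
  assumes U: "unitary U" "dim_row U = n"
    and T: "T = U * real_diag n d * mat_adjoint U"
  shows "mat_fun f T = U * real_diag n (\<lambda>i. f (d i)) * mat_adjoint U"
proof -
  have Uc: "U \<in> carrier_mat n n" using U by (simp add: unitary_def)
  then have nT: "dim_row T = n" by (simp add: T)
  have "V * real_diag n (\<lambda>i. f (e i)) * mat_adjoint V =
        U * real_diag n (\<lambda>i. f (d i)) * mat_adjoint U"
    if V: "unitary V" "dim_row V = n" and TV: "T = V * real_diag n e * mat_adjoint V" for V e
  proof -
    let ?U = "mat_adjoint U" and ?V = "mat_adjoint V"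
    have Vc: "V \<in> carrier_mat n n" using V by (simp add: unitary_def)
    note c = Uc Vc mat_adjoint_carrier[OF Uc] mat_adjoint_carrier[OF Vc]
    have inv: "?U * U = 1\<^sub>m n" "U * ?U = 1\<^sub>m n" "?V * V = 1\<^sub>m n" "V * ?V = 1\<^sub>m n"
      using U V by (auto simp: unitary_def)
    define W where "W = ?V * U"
    have Wc: "W \<in> carrier_mat n n" unfolding W_def using c by simp
    have expand: "W * real_diag n a = ?V * (U * real_diag n a * ?U) * U" for a
    proof -
      have "?V * (U * real_diag n a * ?U) * U = W * real_diag n a * (?U * U)"
        using c real_diag_carrier[of n a] by (simp add: W_def assoc_mult_mat[of _ n n _ n _ n])
      then show ?thesis using Wc real_diag_carrier[of n a] inv by simp
    qed
    have expand': "real_diag n a * W = ?V * (V * real_diag n a * ?V) * U" for a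
    proof -
      have "?V * (V * real_diag n a * ?V) * U = (?V * V) * (real_diag n a * W)"
        using c real_diag_carrier[of n a] by (simp add: W_def assoc_mult_mat[of _ n n _ n _ n])
      then show ?thesis using Wc real_diag_carrier[of n a] inv
        by (simp add: mult_carrier_mat[of _ n n _ n])
    qed
    have comm: "W * real_diag n d = real_diag n e * W"
      by (simp only: expand expand' T[symmetric] TV[symmetric])
    have entry: "W $$ (i,j) * complex_of_real (d j) = complex_of_real (e i) * W $$ (i,j)"
      if "i < n" "j < n" for i j
      using arg_cong[OF comm, of "\<lambda>M. M $$ (i,j)"] that Wc
      by (simp add: real_diag_def mat_diag_mult_left[OF Wc] mat_diag_mult_right[OF Wc])
    have commf: "W * real_diag n (\<lambda>i. f (d i)) = real_diag n (\<lambda>i. f (e i)) * W"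
    proof (rule eq_matI)
      fix i j assume "i < dim_row (real_diag n (\<lambda>i. f (e i)) * W)"
        "j < dim_col (real_diag n (\<lambda>i. f (e i)) * W)"
      then have ij: "i < n" "j < n" using Wc real_diag_carrier[of n "\<lambda>i. f (e i)"] by auto
      have "W $$ (i,j) = 0 \<or> d j = e i" using entry[OF ij] by auto
      then show "(W * real_diag n (\<lambda>i. f (d i))) $$ (i,j) = (real_diag n (\<lambda>i. f (e i)) * W) $$ (i,j)"
        using ij Wc by (auto simp: real_diag_def mat_diag_mult_left[OF Wc] mat_diag_mult_right[OF Wc])
    qed (use Wc in \<open>auto simp: real_diag_def mat_diag_def\<close>)
    let ?D = "real_diag n (\<lambda>i. f (d i))" and ?E = "real_diag n (\<lambda>i. f (e i))"
    note c' = c real_diag_carrier[of n "\<lambda>i. f (d i)"] real_diag_carrier[of n "\<lambda>i. f (e i)"]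
    have "V * (W * ?D) * ?U = (V * ?V) * (U * ?D * ?U)"
      using c' by (simp add: W_def assoc_mult_mat[of _ n n _ n _ n])
    moreover have "V * (?E * W) * ?U = (V * ?E * ?V) * (U * ?U)"
      using c' by (simp add: W_def assoc_mult_mat[of _ n n _ n _ n])
    moreover have "1\<^sub>m n * (U * ?D * ?U) = U * ?D * ?U" "V * ?E * ?V * 1\<^sub>m n = V * ?E * ?V"
      using c' by auto
    ultimately show ?thesis
      by (simp only: commf inv)
  qed
  note unique = this
  show ?thesis
    unfolding mat_fun_def nT
  proof (rule the_equality, goal_cases)
    case 1
    show ?case using U T by (intro exI[of _ U] exI[of _ d] conjI refl)
  next
    case (2 A)
    then obtain V e where V: "unitary V" "dim_row V = n" "T = V * real_diag n e * mat_adjoint V"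
      and A: "A = V * real_diag n (\<lambda>i. f (e i)) * mat_adjoint V" by (elim exE conjE)
    show ?case unfolding A by (rule unique[OF V])
  qed
qed

definition matrix_convex_on :: "real set \<Rightarrow> (real \<Rightarrow> real) \<Rightarrow> bool" where
  "matrix_convex_on I f \<longleftrightarrow> (\<forall>n. \<forall>T\<^sub>1 \<in> carrier_mat n n. \<forall>T\<^sub>2 \<in> carrier_mat n n. \<forall>c :: real.
     hermitian T\<^sub>1 \<and> spectrum_in T\<^sub>1 I \<and> hermitian T\<^sub>2 \<and> spectrum_in T\<^sub>2 I \<and> 0 \<le> c \<and> c \<le> 1 \<longrightarrow>
     loewner_le
       (mat_fun f (complex_of_real c \<cdot>\<^sub>m T\<^sub>1 + complex_of_real (1 - c) \<cdot>\<^sub>m T\<^sub>2))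
       (complex_of_real c \<cdot>\<^sub>m mat_fun f T\<^sub>1 + complex_of_real (1 - c) \<cdot>\<^sub>m mat_fun f T\<^sub>2))"

text \<open>\<open>L R\<^sup>-\<^sup>1\<close>, for invertible \<open>R\<close>.\<close>
definition mat_quotient :: "complex mat \<Rightarrow> complex mat \<Rightarrow> complex mat" where
  "mat_quotient L R = L * the (mat_inverse R)"

definition perspective :: "(real \<Rightarrow> real) \<Rightarrow> complex mat \<Rightarrow> complex mat \<Rightarrow> complex mat" where
  "perspective f L R = mat_fun f (mat_quotient L R) * R"

definition commutator :: "complex mat \<Rightarrow> complex mat \<Rightarrow> complex mat" where
  "commutator L R = L * R - R * L"

end

theory Submission
  imports Defs
begin

text \<open>If \<open>L\<close> and \<open>R\<close> commute, then \<open>L = R\<^sup>\<onehalf> (L/R) R\<^sup>\<onehalf>\<close> and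
  \<open>g(L,R) = R\<^sup>\<onehalf> f(L/R) R\<^sup>\<onehalf>\<close>. With \<open>A\<^sub>1 = (c R\<^sub>1)\<^sup>\<onehalf> R\<^sup>-\<^sup>\<onehalf>\<close> and
  \<open>A\<^sub>2 = ((1 - c) R\<^sub>2)\<^sup>\<onehalf> R\<^sup>-\<^sup>\<onehalf>\<close> one has \<open>A\<^sub>1\<^sup>* A\<^sub>1 + A\<^sub>2\<^sup>* A\<^sub>2 = 1\<close> and
  \<open>L/R = A\<^sub>1\<^sup>* (L\<^sub>1/R\<^sub>1) A\<^sub>1 + A\<^sub>2\<^sup>* (L\<^sub>2/R\<^sub>2) A\<^sub>2\<close>, so the Hansen--Pedersen--Jensen
  inequality bounds \<open>f(L/R)\<close>; conjugating by \<open>R\<^sup>\<onehalf>\<close> gives the claim. The Jensen inequality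
  comes from \<open>f(V\<^sup>* X V) \<le> V\<^sup>* f(X) V\<close> for isometries \<open>V\<close>, which is convexity
  of \<open>f\<close> at the midpoint of \<open>X\<close> and its image under the reflection in the range of \<open>V\<close>.\<close>

unbundle no vec_syntax

section \<open>Adjoints and the Loewner order\<close>

lemma mat_adjoint_dim [simp]:
  fixes A :: "complex mat"
  shows "dim_row (mat_adjoint A) = dim_col A" "dim_col (mat_adjoint A) = dim_row A"
  by (simp_all add: mat_adjoint_def)

lemma mat_adjoint_index:
  fixes A :: "complex mat"
  shows "i < dim_col A \<Longrightarrow> j < dim_row A \<Longrightarrow> mat_adjoint A $$ (i, j) = cnj (A $$ (j, i))"
  by (simp add: mat_adjoint_def mat_of_rows_index)

lemma mat_adjoint_adjoint [simp]: "mat_adjoint (mat_adjoint A) = (A :: complex mat)"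
  by (rule eq_matI) (auto simp: mat_adjoint_index)

lemma mat_adjoint_mult:
  fixes A B :: "complex mat"
  assumes "A \<in> carrier_mat k m" "B \<in> carrier_mat m n"
  shows "mat_adjoint (A * B) = mat_adjoint B * mat_adjoint A"
  by (rule eq_matI)
    (use assms in \<open>auto simp: mat_adjoint_index scalar_prod_def ac_simps intro!: sum.cong\<close>)

lemma mat_adjoint_add:
  fixes A B :: "complex mat"
  assumes "A \<in> carrier_mat m n" "B \<in> carrier_mat m n"
  shows "mat_adjoint (A + B) = mat_adjoint A + mat_adjoint B"
  by (rule eq_matI) (use assms in \<open>auto simp: mat_adjoint_index\<close>)

lemma mat_adjoint_minus:
  fixes A B :: "complex mat"
  assumes "A \<in> carrier_mat m n" "B \<in> carrier_mat m n"
  shows "mat_adjoint (A - B) = mat_adjoint A - mat_adjoint B"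
  by (rule eq_matI) (use assms in \<open>auto simp: mat_adjoint_index\<close>)

lemma mat_adjoint_smult: "mat_adjoint (a \<cdot>\<^sub>m A) = cnj a \<cdot>\<^sub>m mat_adjoint (A :: complex mat)"
  by (rule eq_matI) (auto simp: mat_adjoint_index)

lemma mat_adjoint_mat_diag: "mat_adjoint (mat_diag n d) = mat_diag n (\<lambda>i. cnj (d i))"
  by (rule eq_matI) (auto simp: mat_adjoint_index mat_diag_def)

lemma mat_adjoint_one [simp]: "mat_adjoint (1\<^sub>m n) = (1\<^sub>m n :: complex mat)"
  by (rule eq_matI) (auto simp: mat_adjoint_index)

lemma hermitian_real_diag: "hermitian (real_diag n d)"
  by (simp add: hermitian_def real_diag_def mat_adjoint_mat_diag)

lemma cscalar_prod_mat_adjoint: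
  fixes A :: "complex mat"
  assumes A: "A \<in> carrier_mat m n" and v: "v \<in> carrier_vec n" and w: "w \<in> carrier_vec m"
  shows "(A *\<^sub>v v) \<bullet>c w = v \<bullet>c (mat_adjoint A *\<^sub>v w)"
proof -
  have "(A *\<^sub>v v) \<bullet>c w = (\<Sum>i<m. \<Sum>j<n. A $$ (i,j) * v $ j * cnj (w $ i))"
    using assms by (simp add: scalar_prod_def sum_distrib_right lessThan_atLeast0)
  also have "\<dots> = (\<Sum>j<n. \<Sum>i<m. A $$ (i,j) * v $ j * cnj (w $ i))"
    by (rule sum.swap)
  also have "\<dots> = v \<bullet>c (mat_adjoint A *\<^sub>v w)"
    using assms by (auto simp: scalar_prod_def sum_distrib_left lessThan_atLeast0 mat_adjoint_index
        ac_simps intro!: sum.cong)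
  finally show ?thesis .
qed

lemma hermitian_congruence:
  assumes "X \<in> carrier_mat m m" "V \<in> carrier_mat m n" "hermitian X"
  shows "hermitian (mat_adjoint V * X * V)"
proof -
  note V' = mat_adjoint_carrier[OF assms(2)]
  have "mat_adjoint (mat_adjoint V * X * V) = mat_adjoint V * mat_adjoint X * V"
    using assms V' by (simp add: mat_adjoint_mult[of _ n m _ n] mat_adjoint_mult[of _ m m _ n])
  then show ?thesis
    using assms by (simp add: hermitian_def)
qed

text \<open>The quadratic form of \<open>mat_adjoint V * (Y - X) * V\<close> at \<open>v\<close> is
  that of \<open>Y - X\<close> at the image of \<open>v\<close> under \<open>V\<close>.
  \<open>V\<close> may be rectangular, as compressions by an isometry require.\<close>

lemma loewner_le_congruence:
  assumes X: "X \<in> carrier_mat m m" and Y: "Y \<in> carrier_mat m m" and V: "V \<in> carrier_mat m n"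
    and le: "loewner_le X Y"
  shows "loewner_le (mat_adjoint V * X * V) (mat_adjoint V * Y * V)"
proof -
  note V' = mat_adjoint_carrier[OF V]
  have YX: "Y - X \<in> carrier_mat m m" using X by (rule minus_carrier_mat)
  have "mat_adjoint V * Y * V - mat_adjoint V * X * V = mat_adjoint V * (Y - X) * V"
    using X Y V V' by (simp add: mult_minus_distrib_mat[of _ n m] minus_mult_distrib_mat[of _ n m])
  moreover have "pos_semidef (mat_adjoint V * (Y - X) * V)"
    unfolding pos_semidef_def
  proof (intro conjI ballI)
    show "hermitian (mat_adjoint V * (Y - X) * V)"
      using le by (intro hermitian_congruence[OF YX V]) (simp add: loewner_le_def pos_semidef_def)
    fix v :: "complex vec" assume "v \<in> carrier_vec (dim_row (mat_adjoint V * (Y - X) * V))"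
    then have v: "v \<in> carrier_vec n" using V by simp
    have Vv: "V *\<^sub>v v \<in> carrier_vec m" using V v by simp
    have "((mat_adjoint V * (Y - X) * V) *\<^sub>v v) \<bullet>c v
        = (mat_adjoint V *\<^sub>v ((Y - X) *\<^sub>v (V *\<^sub>v v))) \<bullet>c v"
      using V V' YX v by (simp add: assoc_mult_mat_vec[of _ n m _ n] assoc_mult_mat_vec[of _ n m _ m])
    also have "\<dots> = ((Y - X) *\<^sub>v (V *\<^sub>v v)) \<bullet>c (V *\<^sub>v v)"
      using cscalar_prod_mat_adjoint[OF V', of "(Y - X) *\<^sub>v (V *\<^sub>v v)" v] YX Vv v by simp
    finally show "0 \<le> Re (((mat_adjoint V * (Y - X) * V) *\<^sub>v v) \<bullet>c v)"
      using le Vv YX X by (simp add: loewner_le_def pos_semidef_def)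
  qed
  ultimately show ?thesis
    using le X Y V V' hermitian_congruence[OF X V] hermitian_congruence[OF Y V]
    by (simp add: loewner_le_def)
qed

section \<open>Unitary matrices and unitary conjugation\<close>

lemma unitaryI:
  assumes "U \<in> carrier_mat n n" "mat_adjoint U * U = 1\<^sub>m n"
  shows "unitary U"
proof -
  have "U * mat_adjoint U = 1\<^sub>m n"
    by (rule mat_mult_left_right_inverse[OF mat_adjoint_carrier[OF assms(1)] assms])
  with assms show ?thesis by (simp add: unitary_def)
qed

lemma unitaryD:
  assumes "unitary U" "dim_row U = n"
  shows "U \<in> carrier_mat n n" "mat_adjoint U \<in> carrier_mat n n"
    "mat_adjoint U * U = 1\<^sub>m n" "U * mat_adjoint U = 1\<^sub>m n"
  using assms by (auto simp: unitary_def intro: mat_adjoint_carrier)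

lemma unitary_mult:
  assumes "unitary U" "dim_row U = n" "unitary W" "dim_row W = n"
  shows "unitary (U * W)"
proof (rule unitaryI)
  note c = unitaryD[OF assms(1,2)] unitaryD[OF assms(3,4)]
  show "U * W \<in> carrier_mat n n" using c by simp
  have "mat_adjoint (U * W) * (U * W) = mat_adjoint W * (mat_adjoint U * U) * W"
    using c(1,2,5,6) by (simp add: mat_adjoint_mult[of _ n n _ n] assoc_mult_mat[of _ n n _ n _ n])
  then show "mat_adjoint (U * W) * (U * W) = 1\<^sub>m n"
    using c by simp
qed

lemma unitary_conj_mult:
  assumes "unitary U" "dim_row U = n" "A \<in> carrier_mat n n" "B \<in> carrier_mat n n"
  shows "(U * A * mat_adjoint U) * (U * B * mat_adjoint U) = U * (A * B) * mat_adjoint U"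
proof -
  note c = unitaryD[OF assms(1,2)]
  have "(U * A * mat_adjoint U) * (U * B * mat_adjoint U)
      = U * A * (mat_adjoint U * U) * B * mat_adjoint U"
    using c(1,2) assms by (simp add: assoc_mult_mat[of _ n n _ n _ n])
  then show ?thesis
    using c assms by (simp add: assoc_mult_mat[of _ n n _ n _ n])
qed

section \<open>Unitary diagonalization\<close>

text \<open>The reflection exchanging \<open>e\<^sub>0\<close> and \<open>v\<close>; its axis \<open>e\<^sub>0 - v\<close> is nonzero because of the
  sign condition on \<open>v\<^sub>0\<close>.\<close>
lemma householder:
  fixes v :: "complex vec"
  assumes v: "v \<in> carrier_vec (Suc n)" and vv: "v \<bullet>c v = 1"
    and v0: "Im (v $ 0) = 0" "Re (v $ 0) \<le> 0"
  obtains H where "H \<in> carrier_mat (Suc n) (Suc n)" "mat_adjoint H = H" "H * H = 1\<^sub>m (Suc n)"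
    "col H 0 = v"
proof -
  define r where "r = Re (v $ 0)"
  have vr: "v $ 0 = complex_of_real r" using v0 by (simp add: r_def complex_eq_iff)
  \<comment> \<open>For a unit vector with real first entry \<open>r\<close>, the squared norm of
    e_0 - v is 2 (1 - r), so \<open>k\<close> is 2 divided by the squared norm of the reflection
    axis.\<close>
  define k where "k = complex_of_real (1 / (1 - r))"
  have r: "1 - r > 0" using v0 by (simp add: r_def)
  define w :: "complex mat" where
    "w = mat (Suc n) 1 (\<lambda>(i,_). (if i = 0 then 1 else 0) - v $ i)"
  have w: "w \<in> carrier_mat (Suc n) 1" by (simp add: w_def)
  note w' = mat_adjoint_carrier[OF w]
  have vsum: "(\<Sum>i<n. v $ Suc i * cnj (v $ Suc i)) = 1 - complex_of_real r * complex_of_real r"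
    using vv v vr by (simp add: scalar_prod_def sum.atLeast0_lessThan_Suc_shift
        lessThan_atLeast0 algebra_simps del: sum.op_ivl_Suc)
  have ww: "mat_adjoint w * w = (2 / k) \<cdot>\<^sub>m 1\<^sub>m 1"
  proof (rule eq_matI)
    fix i j assume "i < dim_row ((2 / k) \<cdot>\<^sub>m 1\<^sub>m 1)" "j < dim_col ((2 / k) \<cdot>\<^sub>m 1\<^sub>m 1)"
    then have [simp]: "i = 0" "j = 0" by auto
    have "(mat_adjoint w * w) $$ (0, 0)
        = (\<Sum>l<Suc n. cnj (w $$ (l,0)) * w $$ (l,0))"
      using w w' by (simp add: scalar_prod_def mat_adjoint_index lessThan_atLeast0 del: sum.op_ivl_Suc)
    also have "\<dots> = cnj (w $$ (0,0)) * w $$ (0,0) + (\<Sum>l<n. cnj (w $$ (Suc l,0)) * w $$ (Suc l,0))"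
      by (rule sum.lessThan_Suc_shift)
    also have "(\<Sum>l<n. cnj (w $$ (Suc l,0)) * w $$ (Suc l,0)) = (\<Sum>i<n. v $ Suc i * cnj (v $ Suc i))"
      by (rule sum.cong) (auto simp: w_def)
    also have "cnj (w $$ (0,0)) * w $$ (0,0) = (1 - complex_of_real r) * (1 - complex_of_real r)"
      by (simp add: w_def vr)
    finally show "(mat_adjoint w * w) $$ (i, j) = ((2 / k) \<cdot>\<^sub>m 1\<^sub>m 1) $$ (i, j)"
      by (simp add: vsum k_def algebra_simps)
  qed (use w w' in auto)
  define P where "P = w * mat_adjoint w"
  have P: "P \<in> carrier_mat (Suc n) (Suc n)" using w w' by (simp add: P_def)
  \<comment> \<open>This makes 1 - k P an involution: in its square the terms -2 k P and k^2 (2/k) P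
    cancel.\<close>
  have PP: "P * P = (2 / k) \<cdot>\<^sub>m P"
  proof -
    have "P * P = w * (mat_adjoint w * w) * mat_adjoint w"
      using w w' by (simp add: P_def assoc_mult_mat[of _ "Suc n" "Suc 0" _ "Suc n" _ "Suc n"]
          assoc_mult_mat[of _ "Suc n" "Suc 0" _ "Suc 0" _ "Suc n"] assoc_mult_mat[of _ "Suc 0" "Suc n" _ "Suc 0" _ "Suc n"])
    then show ?thesis
      using w w' by (simp add: ww P_def mult_smult_distrib[of _ "Suc n" "Suc 0" _ "Suc 0"]
          mult_smult_assoc_mat[of _ "Suc n" "Suc 0" _ "Suc n"])
  qed
  have r1: "complex_of_real r \<noteq> 1" using r by simp
  have k0: "k \<noteq> 0" using r by (simp add: k_def)
  define H where "H = 1\<^sub>m (Suc n) - k \<cdot>\<^sub>m P"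
  show ?thesis
  proof (rule that)
    show H: "H \<in> carrier_mat (Suc n) (Suc n)" using P by (simp add: H_def minus_carrier_mat)
    have "mat_adjoint P = P"
      using w w' by (simp add: P_def mat_adjoint_mult[of _ "Suc n" "Suc 0"])
    moreover have "cnj k = k" by (simp add: k_def)
    ultimately show "mat_adjoint H = H"
      using P by (simp add: H_def mat_adjoint_minus[of _ "Suc n" "Suc n"] mat_adjoint_smult)
    have "H * H = 1\<^sub>m (Suc n) * H - k \<cdot>\<^sub>m P * H"
      unfolding H_def using P
      by (intro minus_mult_distrib_mat[of _ "Suc n" "Suc n" _ _ "Suc n"] minus_carrier_mat) auto
    also have "k \<cdot>\<^sub>m P * H = k \<cdot>\<^sub>m P * 1\<^sub>m (Suc n) - k \<cdot>\<^sub>m P * (k \<cdot>\<^sub>m P)"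
      unfolding H_def using P
      by (intro mult_minus_distrib_mat[of _ "Suc n" "Suc n" _ "Suc n"]) auto
    also have "k \<cdot>\<^sub>m P * (k \<cdot>\<^sub>m P) = k \<cdot>\<^sub>m (k \<cdot>\<^sub>m (P * P))"
      using P by (simp add: mult_smult_distrib[of _ "Suc n" "Suc n" _ "Suc n"]
          mult_smult_assoc_mat[of _ "Suc n" "Suc n" _ "Suc n"])
    also have "1\<^sub>m (Suc n) * H = H" using H by simp
    finally have "H * H = (1\<^sub>m (Suc n) - k \<cdot>\<^sub>m P) - (k \<cdot>\<^sub>m P - k \<cdot>\<^sub>m (k \<cdot>\<^sub>m (P * P)))"
      using P by (simp add: H_def)
    also have "\<dots> = 1\<^sub>m (Suc n)"
      using P k0 by (intro eq_matI) (auto simp: PP)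
    finally show "H * H = 1\<^sub>m (Suc n)" .
    show "col H 0 = v"
    proof (rule eq_vecI)
      fix i assume "i < dim_vec v"
      then have i: "i < Suc n" using v by simp
      \<comment> \<open>Column 0 of \<open>P\<close> is \<open>w\<close> times the conjugate of its
        first entry 1 - r. The factor \<open>k\<close> cancels that scalar, so column 0 of
        \<open>H\<close> is e_0 - w = v.\<close>
      have "P $$ (i, 0) = w $$ (i,0) * (1 - complex_of_real r)"
        using i w w' by (simp add: P_def scalar_prod_def mat_adjoint_index w_def vr)
      then have "k * P $$ (i, 0) = w $$ (i, 0)"
        using r1 by (simp add: k_def)
      then show "col H 0 $ i = v $ i"
        using i P by (simp add: H_def) (simp add: w_def)
    qed (use H v in auto)
  qed
qed

text \<open>Comparing the (0,0) entries of \<open>M M\<^sup>*\<close> and \<open>M\<^sup>* M\<close> kills the off-diagonal part of the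
  first row.\<close>
lemma normal_deflate:
  fixes M :: "complex mat"
  assumes M: "M \<in> carrier_mat (Suc n) (Suc n)"
    and normal: "M * mat_adjoint M = mat_adjoint M * M"
    and col0: "\<And>i. 0 < i \<Longrightarrow> i < Suc n \<Longrightarrow> M $$ (i, 0) = 0"
  obtains a N where "N \<in> carrier_mat n n" "N * mat_adjoint N = mat_adjoint N * N"
    "M = four_block_mat (mat 1 1 (\<lambda>_. a)) (0\<^sub>m 1 n) (0\<^sub>m n 1) N"
proof -
  note M' = mat_adjoint_carrier[OF M]
  have MM: "(M * mat_adjoint M) $$ (i,j) = M $$ (i,0) * cnj (M $$ (j,0)) +
      (\<Sum>l<n. M $$ (i, Suc l) * cnj (M $$ (j, Suc l)))" if "i < Suc n" "j < Suc n" for i j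
  proof -
    have "(M * mat_adjoint M) $$ (i,j) = (\<Sum>l<Suc n. M $$ (i, l) * cnj (M $$ (j, l)))"
      using M M' that by (simp add: scalar_prod_def mat_adjoint_index lessThan_atLeast0 del: sum.op_ivl_Suc)
    also have "\<dots> = M $$ (i,0) * cnj (M $$ (j,0)) +
      (\<Sum>l<n. M $$ (i, Suc l) * cnj (M $$ (j, Suc l)))" by (rule sum.lessThan_Suc_shift)
    finally show ?thesis .
  qed
  have MM': "(mat_adjoint M * M) $$ (i,j) = cnj (M $$ (0,i)) * M $$ (0,j) +
      (\<Sum>l<n. cnj (M $$ (Suc l, i)) * M $$ (Suc l, j))" if "i < Suc n" "j < Suc n" for i j
  proof -
    have "(mat_adjoint M * M) $$ (i,j) = (\<Sum>l<Suc n. cnj (M $$ (l,i)) * M $$ (l,j))"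
      using M M' that by (simp add: scalar_prod_def mat_adjoint_index lessThan_atLeast0 del: sum.op_ivl_Suc)
    also have "\<dots> = cnj (M $$ (0,i)) * M $$ (0,j) +
      (\<Sum>l<n. cnj (M $$ (Suc l, i)) * M $$ (Suc l, j))" by (rule sum.lessThan_Suc_shift)
    finally show ?thesis .
  qed
  \<comment> \<open>At (0,0), \<open>M * mat_adjoint M\<close> sums the squared moduli of row 0 and
    \<open>mat_adjoint M * M\<close> those of column 0; by \<open>col0\<close> the latter reduce to
    the corner entry.\<close>
  have "(\<Sum>l<n. M $$ (0, Suc l) * cnj (M $$ (0, Suc l))) = 0"
    using MM[of 0 0] MM'[of 0 0] normal by (simp add: col0)
  then have "complex_of_real (\<Sum>l<n. (cmod (M $$ (0, Suc l)))\<^sup>2) = 0"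
    by (simp only: of_real_sum complex_norm_square)
  then have "(\<Sum>l<n. (cmod (M $$ (0, Suc l)))\<^sup>2) = 0"
    by (simp only: of_real_eq_0_iff)
  then have row0: "M $$ (0, Suc l) = 0" if "l < n" for l
    using that by (subst (asm) sum_nonneg_eq_0_iff) auto
  define N where "N = mat n n (\<lambda>(i,j). M $$ (Suc i, Suc j))"
  show ?thesis
  proof (rule that)
    show N: "N \<in> carrier_mat n n" by (simp add: N_def)
    note N' = mat_adjoint_carrier[OF N]
    show "N * mat_adjoint N = mat_adjoint N * N"
    proof (rule eq_matI)
      fix i j assume "i < dim_row (mat_adjoint N * N)" "j < dim_col (mat_adjoint N * N)"
      then have ij: "i < n" "j < n" using N by auto
      have "(N * mat_adjoint N) $$ (i,j) = (\<Sum>l<n. M $$ (Suc i, Suc l) * cnj (M $$ (Suc j, Suc l)))"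
        using ij N N' by (simp add: scalar_prod_def mat_adjoint_index lessThan_atLeast0) (simp add: N_def)
      \<comment> \<open>The extra summand of index 0 vanishes by \<open>col0\<close> here, and by
        \<open>row0\<close> in the reversed product.\<close>
      also have "\<dots> = (M * mat_adjoint M) $$ (Suc i, Suc j)"
        using ij by (simp add: MM col0)
      also have "\<dots> = (\<Sum>l<n. cnj (M $$ (Suc l, Suc i)) * M $$ (Suc l, Suc j))"
        unfolding normal using ij by (simp add: MM' row0)
      also have "\<dots> = (mat_adjoint N * N) $$ (i,j)"
        using ij N N' by (simp add: scalar_prod_def mat_adjoint_index lessThan_atLeast0) (simp add: N_def)
      finally show "(N * mat_adjoint N) $$ (i, j) = (mat_adjoint N * N) $$ (i, j)" .
    qed (use N in auto)
    show "M = four_block_mat (mat 1 1 (\<lambda>_. M $$ (0,0))) (0\<^sub>m 1 n) (0\<^sub>m n 1) N"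
    proof (rule eq_matI)
      fix i j
      assume "i < dim_row (four_block_mat (mat 1 1 (\<lambda>_. M $$ (0,0))) (0\<^sub>m 1 n) (0\<^sub>m n 1) N)"
        "j < dim_col (four_block_mat (mat 1 1 (\<lambda>_. M $$ (0,0))) (0\<^sub>m 1 n) (0\<^sub>m n 1) N)"
      then have "i < Suc n" "j < Suc n" using N by auto
      then show "M $$ (i, j) = four_block_mat (mat 1 1 (\<lambda>_. M $$ (0,0))) (0\<^sub>m 1 n) (0\<^sub>m n 1) N $$ (i, j)"
        using N col0 row0 by (cases i; cases j) (auto simp: N_def)
    qed (use M N in auto)
  qed
qed

text \<open>Positive dimension gives an eigenvector; its length and phase are free and are chosen to
  meet the hypotheses of \<open>householder\<close>.\<close>

lemma unit_eigenvector:
  fixes A :: "complex mat"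
  assumes A: "A \<in> carrier_mat (Suc n) (Suc n)"
  obtains v a where "v \<in> carrier_vec (Suc n)" "A *\<^sub>v v = a \<cdot>\<^sub>v v" "v \<bullet>c v = 1"
    "Im (v $ 0) = 0" "Re (v $ 0) \<le> 0"
proof -
  obtain a u where u: "u \<in> carrier_vec (Suc n)" "u \<noteq> 0\<^sub>v (Suc n)" "A *\<^sub>v u = a \<cdot>\<^sub>v u"
    using spectrum_non_empty[OF A] A by (auto simp: spectrum_def eigenvalue_def eigenvector_def)
  define s where "s = sqrt (Re (u \<bullet>c u))"
  have uu: "u \<bullet>c u > 0" using u by (simp add: conjugate_square_greater_0_vec)
  then have s: "s > 0" "u \<bullet>c u = complex_of_real (s * s)"
    by (auto simp: s_def less_complex_def complex_eq_iff)
  \<comment> \<open>Division by \<open>s\<close> normalizes the length, and the phase turns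
    \<open>u $ 0\<close> into minus its modulus. If that entry is zero, any phase will do.\<close>
  define b where "b = (if u $ 0 = 0 then 1 else - cnj (u $ 0) / cmod (u $ 0)) / s"
  have "cmod b = 1 / s"
    using s by (simp add: b_def norm_divide norm_mult)
  then have b: "b * cnj b = 1 / (s * s)"
    by (simp flip: complex_norm_square add: power2_eq_square)
  show ?thesis
  proof (rule that)
    show "b \<cdot>\<^sub>v u \<in> carrier_vec (Suc n)" using u by simp
    show "A *\<^sub>v (b \<cdot>\<^sub>v u) = a \<cdot>\<^sub>v (b \<cdot>\<^sub>v u)"
      using A u by (simp add: mult_mat_vec[of A "Suc n" "Suc n"] smult_smult_assoc mult.commute)
    have "(b \<cdot>\<^sub>v u) \<bullet>c (b \<cdot>\<^sub>v u) = b * cnj b * (u \<bullet>c u)"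
      using u by (simp add: conjugate_smult_vec)
    then show "(b \<cdot>\<^sub>v u) \<bullet>c (b \<cdot>\<^sub>v u) = 1"
      using s by (simp add: b)
    have bu0: "(b \<cdot>\<^sub>v u) $ 0 = complex_of_real (- cmod (u $ 0) / s)"
    proof (cases "u $ 0 = 0")
      case False
      have "cnj (u $ 0) * u $ 0 = complex_of_real (cmod (u $ 0)) * complex_of_real (cmod (u $ 0))"
        by (metis complex_norm_square mult.commute power2_eq_square of_real_mult)
      with False s u show ?thesis
        by (simp add: b_def divide_simps)
    qed (use u in simp)
    show "Im ((b \<cdot>\<^sub>v u) $ 0) = 0" "Re ((b \<cdot>\<^sub>v u) $ 0) \<le> 0"
      unfolding bu0 Im_complex_of_real Re_complex_of_real using s by simp_all
  qed
qed

lemma block_diag_mult: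
  fixes A B :: "complex mat"
  assumes "A \<in> carrier_mat k k" "A' \<in> carrier_mat k k" "B \<in> carrier_mat n n" "B' \<in> carrier_mat n n"
  shows "four_block_mat A (0\<^sub>m k n) (0\<^sub>m n k) B * four_block_mat A' (0\<^sub>m k n) (0\<^sub>m n k) B'
    = four_block_mat (A * A') (0\<^sub>m k n) (0\<^sub>m n k) (B * B')"
  using assms by (subst mult_four_block_mat[of _ k k _ n _ n _ _ k _ n]) auto

text \<open>Induction on the dimension: a reflection moves a unit eigenvector to e_0, normality
  splits off a block of size one, and the remaining block is again normal. Treating normal matrices,
  not just self-adjoint ones, later yields a common eigenbasis for commuting pairs.\<close>

theorem normal_unitary_diagonalization:
  fixes A :: "complex mat"
  assumes "A \<in> carrier_mat n n" "A * mat_adjoint A = mat_adjoint A * A"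
  shows "\<exists>U d. unitary U \<and> dim_row U = n \<and> A = U * mat_diag n d * mat_adjoint U"
  using assms
proof (induction n arbitrary: A)
  case 0
  have "unitary (1\<^sub>m 0)" by (rule unitaryI[of _ 0]) auto
  moreover have "A = 1\<^sub>m 0 * mat_diag 0 (\<lambda>_. 0) * mat_adjoint (1\<^sub>m 0)"
    using 0 by (intro eq_matI) (auto simp: mat_diag_def)
  ultimately show ?case by (intro exI[of _ "1\<^sub>m 0"] exI[of _ "\<lambda>_. 0"]) simp
next
  case (Suc n)
  note A = Suc.prems(1)
  note A' = mat_adjoint_carrier[OF A]
  obtain v a where v: "v \<in> carrier_vec (Suc n)" "A *\<^sub>v v = a \<cdot>\<^sub>v v" "v \<bullet>c v = 1"
    "Im (v $ 0) = 0" "Re (v $ 0) \<le> 0"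
    using unit_eigenvector[OF A] .
  obtain H where H: "H \<in> carrier_mat (Suc n) (Suc n)" "mat_adjoint H = H" "H * H = 1\<^sub>m (Suc n)"
    "col H 0 = v"
    using householder[OF v(1,3-5)] .
  define M where "M = H * A * H"
  have M: "M \<in> carrier_mat (Suc n) (Suc n)" using H A by (simp add: M_def)
  have HU: "unitary H" "dim_row H = Suc n" using H by (auto intro!: unitaryI[of H "Suc n"])
  have M_adj: "mat_adjoint M = H * mat_adjoint A * H"
    using H A A' by (simp add: M_def mat_adjoint_mult[of _ "Suc n" "Suc n" _ "Suc n"])
  have normal: "M * mat_adjoint M = mat_adjoint M * M"
    unfolding M_adj
    using unitary_conj_mult[OF HU A A'] unitary_conj_mult[OF HU A' A] Suc.prems(2)
    by (simp only: M_def H(2))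
  \<comment> \<open>\<open>v\<close> is column 0 of the involution \<open>H\<close>, so
    \<open>H\<close> sends it back to e_0, which is therefore an eigenvector of
    \<open>M\<close>.\<close>
  have HAH: "col M 0 = a \<cdot>\<^sub>v unit_vec (Suc n) 0"
  proof -
    have "col M 0 = (H * A) *\<^sub>v v"
      unfolding M_def using H A by (subst col_mult2[of _ "Suc n" "Suc n" _ "Suc n"]) auto
    also have "\<dots> = H *\<^sub>v (a \<cdot>\<^sub>v v)"
      using H A v by (simp add: assoc_mult_mat_vec[of _ "Suc n" "Suc n" _ "Suc n"])
    also have "\<dots> = a \<cdot>\<^sub>v (H *\<^sub>v col H 0)"
      using H v by (simp add: mult_mat_vec[of _ "Suc n" "Suc n"])
    also have "H *\<^sub>v col H 0 = col (H * H) 0"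
      using H by (subst col_mult2[of _ "Suc n" "Suc n" _ "Suc n"]) auto
    also have "\<dots> = unit_vec (Suc n) 0" by (simp add: H(3))
    finally show ?thesis .
  qed
  have col0: "M $$ (i, 0) = 0" if "0 < i" "i < Suc n" for i
    using arg_cong[OF HAH, of "\<lambda>w. w $ i"] that M by simp
  obtain b N where N: "N \<in> carrier_mat n n" "N * mat_adjoint N = mat_adjoint N * N"
    "M = four_block_mat (mat 1 1 (\<lambda>_. b)) (0\<^sub>m 1 n) (0\<^sub>m n 1) N"
    using normal_deflate[OF M normal col0] .
  obtain V d where V: "unitary V" "dim_row V = n" "N = V * mat_diag n d * mat_adjoint V"
    using Suc.IH[OF N(1,2)] by auto
  note Vc = unitaryD[OF V(1,2)]
  define W where "W = four_block_mat (1\<^sub>m 1) (0\<^sub>m 1 n) (0\<^sub>m n 1) V"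
  have Wadj: "mat_adjoint W = four_block_mat (1\<^sub>m 1) (0\<^sub>m 1 n) (0\<^sub>m n 1) (mat_adjoint V)"
    using Vc by (intro eq_matI) (auto simp: W_def mat_adjoint_index)
  have Wc: "W \<in> carrier_mat (Suc n) (Suc n)"
    using four_block_carrier_mat[OF one_carrier_mat Vc(1), of 1] by (simp add: W_def)
  have WU: "unitary W" "dim_row W = Suc n"
  proof -
    have "mat_adjoint W * W = four_block_mat (1\<^sub>m 1) (0\<^sub>m 1 n) (0\<^sub>m n 1) (1\<^sub>m n)"
      unfolding Wadj unfolding W_def
      using block_diag_mult[OF one_carrier_mat one_carrier_mat Vc(2,1), of 1] by (simp add: Vc(3))
    then show "unitary W" using Wc by (intro unitaryI[of _ "Suc n"]) auto
  qed (use Wc in auto)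
  have b: "mat 1 1 (\<lambda>_. b) \<in> carrier_mat 1 1" by simp
  \<comment> \<open>\<open>case_nat b d\<close> puts the split-off eigenvalue at index 0 and shifts
    the others by one.\<close>
  have diag: "mat_diag (Suc n) (case_nat b d) = four_block_mat (mat 1 1 (\<lambda>_. b)) (0\<^sub>m 1 n) (0\<^sub>m n 1) (mat_diag n d)"
    by (intro eq_matI) (auto simp: mat_diag_def split: nat.split)
  have "W * mat_diag (Suc n) (case_nat b d)
      = four_block_mat (mat 1 1 (\<lambda>_. b)) (0\<^sub>m 1 n) (0\<^sub>m n 1) (V * mat_diag n d)"
    unfolding W_def diag
    using block_diag_mult[OF one_carrier_mat b Vc(1) mat_diag_dim[of n d]] b by (simp only: left_mult_one_mat)
  then have "W * mat_diag (Suc n) (case_nat b d) * mat_adjoint W = M"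
    unfolding Wadj N(3) V(3)
    using block_diag_mult[OF b one_carrier_mat mult_carrier_mat[OF Vc(1) mat_diag_dim[of n d]] Vc(2)] b
    by (simp only: right_mult_one_mat)
  moreover have "H * M * H = A"
  proof -
    have "H * M * H = (H * H) * A * (H * H)"
      using H(1) A by (simp only: M_def assoc_mult_mat[of _ "Suc n" "Suc n" _ "Suc n" _ "Suc n"] mult_carrier_mat)
    then show ?thesis using A by (simp add: H(3))
  qed
  moreover have "(H * W) * mat_diag (Suc n) (case_nat b d) * mat_adjoint (H * W)
      = H * (W * mat_diag (Suc n) (case_nat b d) * mat_adjoint W) * H"
    using H(1,2) Wc mat_adjoint_carrier[OF Wc] mat_diag_dim[of "Suc n" "case_nat b d"]
    by (simp add: mat_adjoint_mult[of _ "Suc n" "Suc n" _ "Suc n"]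
         assoc_mult_mat[of _ "Suc n" "Suc n" _ "Suc n" _ "Suc n"] mult_carrier_mat[of _ "Suc n" "Suc n" _ "Suc n"])
  ultimately have "A = (H * W) * mat_diag (Suc n) (case_nat b d) * mat_adjoint (H * W)"
    by simp
  then show ?case
    using unitary_mult[OF HU WU] H(1) by (intro exI[of _ "H * W"] exI[of _ "case_nat b d"]) auto
qed

section \<open>Simultaneous diagonalization of commuting self-adjoint matrices\<close>

lemma real_diag_mult: "real_diag n d * real_diag n e = real_diag n (\<lambda>i. d i * e i)"
  by (simp add: real_diag_def)

lemma hermitian_conj_real_diag:
  assumes "unitary U" "dim_row U = n"
  shows "hermitian (U * real_diag n d * mat_adjoint U)"
  using hermitian_congruence[OF real_diag_carrier unitaryD(2)[OF assms] hermitian_real_diag] by simp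

text \<open>Apply the normal case to \<open>A + \<i> B\<close>.\<close>
theorem commuting_hermitian_diagonalization:
  assumes A: "A \<in> carrier_mat n n" "hermitian A" and B: "B \<in> carrier_mat n n" "hermitian B"
    and comm: "A * B = B * A"
  shows "\<exists>U a b. unitary U \<and> dim_row U = n \<and> A = U * real_diag n a * mat_adjoint U
    \<and> B = U * real_diag n b * mat_adjoint U"
proof -
  have adj: "mat_adjoint A = A" "mat_adjoint B = B" using A B by (auto simp: hermitian_def)
  define N where "N = A + \<i> \<cdot>\<^sub>m B"
  define N' where "N' = A + (- \<i>) \<cdot>\<^sub>m B"
  have N: "N \<in> carrier_mat n n" "N' \<in> carrier_mat n n" using A B by (auto simp: N_def N'_def)
  have N': "mat_adjoint N = N'"
    using A B by (simp add: N_def N'_def mat_adjoint_add[of _ n n] mat_adjoint_smult adj)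
  \<comment> \<open>By \<open>comm\<close> both cross terms are multiples of \<open>A * B\<close>,
    so the result is symmetric in \<open>x\<close> and \<open>y\<close>. Taking the two orders of i
    and -i shows that \<open>N\<close> is normal.\<close>
  have expand: "(A + x \<cdot>\<^sub>m B) * (A + y \<cdot>\<^sub>m B) = (A * A + x \<cdot>\<^sub>m (A * B)) + (y \<cdot>\<^sub>m (A * B) + (x * y) \<cdot>\<^sub>m (B * B))"
    for x y
  proof -
    have "(A + x \<cdot>\<^sub>m B) * (A + y \<cdot>\<^sub>m B) = (A * A + x \<cdot>\<^sub>m B * A) + (A * (y \<cdot>\<^sub>m B) + x \<cdot>\<^sub>m B * (y \<cdot>\<^sub>m B))"
      using A B by (simp add: add_mult_distrib_mat[of _ n n _ _ n] mult_add_distrib_mat[of _ n n _ n])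
    moreover have "A * (y \<cdot>\<^sub>m B) = y \<cdot>\<^sub>m (A * B)" "x \<cdot>\<^sub>m B * A = x \<cdot>\<^sub>m (A * B)"
      "x \<cdot>\<^sub>m B * (y \<cdot>\<^sub>m B) = (x * y) \<cdot>\<^sub>m (B * B)"
      using A B by (auto simp: mult_smult_distrib[of _ n n _ n] mult_smult_assoc_mat[of _ n n _ n] comm
          intro!: eq_matI)
    ultimately show ?thesis by (simp only:)
  qed
  have "N * N' = N' * N"
    unfolding N_def N'_def expand using A B by (intro eq_matI) auto
  then obtain U d where U: "unitary U" "dim_row U = n" and Nd: "N = U * mat_diag n d * mat_adjoint U"
    using normal_unitary_diagonalization[OF N(1)] by (auto simp: N')
  note c = unitaryD[OF U]
  have N'd: "N' = U * mat_diag n (\<lambda>i. cnj (d i)) * mat_adjoint U"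
    using mat_adjoint_mult[OF mult_carrier_mat[OF c(1) mat_diag_dim[of n d]] c(2)]
      mat_adjoint_mult[OF c(1) mat_diag_dim[of n d]] assoc_mult_mat[OF c(1) mat_diag_dim c(2)]
    by (simp only: N'[symmetric] Nd mat_adjoint_mat_diag mat_adjoint_adjoint)
  have lin: "x \<cdot>\<^sub>m (U * mat_diag n p * mat_adjoint U) + y \<cdot>\<^sub>m (U * mat_diag n q * mat_adjoint U)
      = U * mat_diag n (\<lambda>i. x * p i + y * q i) * mat_adjoint U" for x y p q
  proof -
    have "mat_diag n (\<lambda>i. x * p i + y * q i) = x \<cdot>\<^sub>m mat_diag n p + y \<cdot>\<^sub>m mat_diag n q"
      by (rule eq_matI) (auto simp: mat_diag_def)
    then show ?thesis
      using c by (simp add: mult_smult_distrib[of _ n n _ n] mult_smult_assoc_mat[of _ n n _ n]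
          add_mult_distrib_mat[of _ n n _ _ n] mult_add_distrib_mat[of _ n n _ n])
  qed
  \<comment> \<open>\<open>A\<close> and \<open>B\<close> are the real part (N + N')/2 and the
    imaginary part (N - N')/(2i) of \<open>N\<close>, so their eigenvalues are the real and
    imaginary parts of \<open>d\<close>.\<close>
  have "A = (1/2) \<cdot>\<^sub>m N + (1/2) \<cdot>\<^sub>m N'"
    using A B by (intro eq_matI) (auto simp: N_def N'_def field_simps)
  also have "\<dots> = U * real_diag n (\<lambda>i. Re (d i)) * mat_adjoint U"
    unfolding Nd N'd lin real_diag_def
    by (intro arg_cong2[where f = "(*)"] arg_cong[where f = "mat_diag n"] ext refl) (simp add: complex_eq_iff)
  finally have A': "A = U * real_diag n (\<lambda>i. Re (d i)) * mat_adjoint U" .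
  have "B = (-\<i>/2) \<cdot>\<^sub>m N + (\<i>/2) \<cdot>\<^sub>m N'"
    using A B by (intro eq_matI) (auto simp: N_def N'_def field_simps)
  also have "\<dots> = U * real_diag n (\<lambda>i. Im (d i)) * mat_adjoint U"
    unfolding Nd N'd lin real_diag_def
    by (intro arg_cong2[where f = "(*)"] arg_cong[where f = "mat_diag n"] ext refl) (simp add: complex_eq_iff)
  finally have "B = U * real_diag n (\<lambda>i. Im (d i)) * mat_adjoint U" .
  with A' U show ?thesis by blast
qed

corollary hermitian_diagonalization:
  assumes "A \<in> carrier_mat n n" "hermitian A"
  shows "\<exists>U d. unitary U \<and> dim_row U = n \<and> A = U * real_diag n d * mat_adjoint U"
  using commuting_hermitian_diagonalization[OF assms assms refl] by blast

text \<open>Since \<open>mat_fun\<close> is a definite description, even its dimension is read off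
  from a diagonalization.\<close>

lemma mat_fun_carrier:
  assumes "T \<in> carrier_mat n n" "hermitian T"
  shows "mat_fun f T \<in> carrier_mat n n"
proof -
  obtain U d where U: "unitary U" "dim_row U = n" "T = U * real_diag n d * mat_adjoint U"
    using hermitian_diagonalization[OF assms] by blast
  show ?thesis
    unfolding mat_fun_eq[OF U] using unitaryD[OF U(1,2)]
    by (auto intro!: mult_carrier_mat[of _ n n _ n] real_diag_carrier)
qed

section \<open>Jensen's operator inequality\<close>

text \<open>In eigenbases of \<open>X\<close> and \<open>K\<close> the hypothesis says that the matrix of \<open>V\<close> has zero entries
  wherever the two eigenvalues differ.\<close>
lemma mat_fun_intertwine:
  assumes X: "X \<in> carrier_mat m m" "hermitian X" and K: "K \<in> carrier_mat n n" "hermitian K"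
    and V: "V \<in> carrier_mat m n" and XV: "X * V = V * K"
  shows "mat_fun f X * V = V * mat_fun f K"
proof -
  obtain U d where U: "unitary U" "dim_row U = m" "X = U * real_diag m d * mat_adjoint U"
    using hermitian_diagonalization[OF X] by blast
  obtain W e where W: "unitary W" "dim_row W = n" "K = W * real_diag n e * mat_adjoint W"
    using hermitian_diagonalization[OF K] by blast
  note uc = unitaryD[OF U(1,2)] and wc = unitaryD[OF W(1,2)]
  \<comment> \<open>\<open>Z\<close> is the matrix of \<open>V\<close> with respect to the two
    eigenbases.\<close>
  define Z where "Z = mat_adjoint U * V * W"
  have Z: "Z \<in> carrier_mat m n" using uc wc V by (auto simp: Z_def)
  have VZ: "V = U * Z * mat_adjoint W"
  proof -
    have "U * Z * mat_adjoint W = (U * mat_adjoint U) * V * (W * mat_adjoint W)"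
      using uc(1,2) wc(1,2) V by (simp add: Z_def assoc_mult_mat[of _ m m _ m _ n]
          assoc_mult_mat[of _ m m _ n _ n] assoc_mult_mat[of _ m n _ n _ n])
    then show ?thesis using V uc wc by simp
  qed
  \<comment> \<open>\<open>left\<close> and \<open>right\<close> are stated for every diagonal
    \<open>a\<close>: they serve first for the eigenvalues and at the end for their images under
    \<open>f\<close>.\<close>
  have left: "U * real_diag m a * mat_adjoint U * V = U * (real_diag m a * Z) * mat_adjoint W" for a
  proof -
    have "U * real_diag m a * mat_adjoint U * V
        = U * real_diag m a * (mat_adjoint U * U) * (Z * mat_adjoint W)"
      using uc(1,2) wc(1,2) Z real_diag_carrier[of m a]
      by (simp add: VZ assoc_mult_mat[of _ m m _ m _ n]
          assoc_mult_mat[of _ m m _ n _ n] assoc_mult_mat[of _ m m _ m _ m])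
    then show ?thesis
      using uc wc Z real_diag_carrier[of m a]
      by (simp add: assoc_mult_mat[of _ m m _ m _ n] assoc_mult_mat[of _ m m _ n _ n])
  qed
  have right: "V * (W * real_diag n a * mat_adjoint W) = U * (Z * real_diag n a) * mat_adjoint W" for a
  proof -
    have "V * (W * real_diag n a * mat_adjoint W)
        = U * Z * (mat_adjoint W * W) * (real_diag n a * mat_adjoint W)"
      using uc(1,2) wc(1,2) Z real_diag_carrier[of n a]
      by (simp add: VZ assoc_mult_mat[of _ m m _ n _ n]
          assoc_mult_mat[of _ m n _ n _ n] assoc_mult_mat[of _ n n _ n _ n])
    then show ?thesis
      using uc wc Z real_diag_carrier[of n a]
      by (simp add: assoc_mult_mat[of _ m m _ n _ n] assoc_mult_mat[of _ m n _ n _ n])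
  qed
  have strip: "mat_adjoint U * (U * Y * mat_adjoint W) * W = Y" if Y: "Y \<in> carrier_mat m n" for Y
  proof -
    have "mat_adjoint U * (U * Y * mat_adjoint W) * W = (mat_adjoint U * U) * Y * (mat_adjoint W * W)"
      using uc(1,2) wc(1,2) Y by (simp add: assoc_mult_mat[of _ m m _ m _ n]
          assoc_mult_mat[of _ m m _ n _ n] assoc_mult_mat[of _ m n _ n _ n])
    then show ?thesis using Y uc wc by simp
  qed
  have eq: "U * (real_diag m d * Z) * mat_adjoint W = U * (Z * real_diag n e) * mat_adjoint W"
    using XV by (simp only: left[symmetric] right[symmetric] U(3) W(3))
  have "real_diag m d * Z = mat_adjoint U * (U * (real_diag m d * Z) * mat_adjoint W) * W"
    by (rule strip[symmetric, OF mult_carrier_mat[OF real_diag_carrier Z]])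
  also have "\<dots> = Z * real_diag n e"
    unfolding eq by (rule strip[OF mult_carrier_mat[OF Z real_diag_carrier]])
  finally have comm: "real_diag m d * Z = Z * real_diag n e" .
  have "real_diag m (\<lambda>i. f (d i)) * Z = Z * real_diag n (\<lambda>i. f (e i))"
  proof (rule eq_matI)
    fix i j assume "i < dim_row (Z * real_diag n (\<lambda>i. f (e i)))"
      "j < dim_col (Z * real_diag n (\<lambda>i. f (e i)))"
    then have ij: "i < m" "j < n" using Z real_diag_carrier[of n "\<lambda>i. f (e i)"] by auto
    \<comment> \<open>The entry is annihilated by d i - e j, so it is zero or the eigenvalues agree;
      in the second case their images under \<open>f\<close> agree as well.\<close>
    have "complex_of_real (d i) * Z $$ (i,j) = Z $$ (i,j) * complex_of_real (e j)"
      using arg_cong[OF comm, of "\<lambda>M. M $$ (i,j)"] ij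
      by (simp add: real_diag_def mat_diag_mult_left[OF Z] mat_diag_mult_right[OF Z])
    then have "Z $$ (i,j) = 0 \<or> d i = e j" by auto
    then show "(real_diag m (\<lambda>i. f (d i)) * Z) $$ (i, j) = (Z * real_diag n (\<lambda>i. f (e i))) $$ (i, j)"
      using ij by (auto simp: real_diag_def mat_diag_mult_left[OF Z] mat_diag_mult_right[OF Z])
  qed (use Z in \<open>auto simp: real_diag_def mat_diag_def\<close>)
  then show ?thesis
    unfolding mat_fun_eq[OF U] mat_fun_eq[OF W] left right by simp
qed

text \<open>With the reflection \<open>E = 2 V V\<^sup>* - 1\<close>, the average of \<open>X\<close> and \<open>E X E\<close> commutes with
  \<open>V V\<^sup>*\<close>, so its \<open>f\<close>-image compresses to \<open>f (V\<^sup>* X V)\<close>.\<close>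
lemma matrix_convex_compression:
  assumes f: "matrix_convex_on I f" and X: "X \<in> carrier_mat m m" "hermitian X" "spectrum_in X I"
    and V: "V \<in> carrier_mat m n" "mat_adjoint V * V = 1\<^sub>m n"
  shows "loewner_le (mat_fun f (mat_adjoint V * X * V)) (mat_adjoint V * mat_fun f X * V)"
proof -
  note V' = mat_adjoint_carrier[OF V(1)]
  define P where "P = V * mat_adjoint V"
  have P: "P \<in> carrier_mat m m" using V V' by (simp add: P_def)
  have PV: "P * V = V"
    using V V' by (simp add: P_def assoc_mult_mat[of _ m n _ m _ n])
  have PP: "P * P = P"
  proof -
    have "P * P = (P * V) * mat_adjoint V"
      using V V' P by (subst (2) P_def) (simp add: assoc_mult_mat[of _ m m _ n _ m])
    then show ?thesis unfolding PV by (simp only: P_def)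
  qed
  have adjP: "mat_adjoint P = P"
    using V V' by (simp add: P_def mat_adjoint_mult[of _ m n _ m])
  define E where "E = 2 \<cdot>\<^sub>m P - 1\<^sub>m m"
  have E: "E \<in> carrier_mat m m" by (simp add: E_def minus_carrier_mat)
  have EA: "E * A = 2 \<cdot>\<^sub>m (P * A) - A" if "A \<in> carrier_mat m k" for A k
    using that P by (simp add: E_def minus_mult_distrib_mat[of _ m m _ _ k] mult_smult_assoc_mat[of _ m m _ k])
  have AE: "A * E = 2 \<cdot>\<^sub>m (A * P) - A" if "A \<in> carrier_mat k m" for A k
    using that P by (simp add: E_def mult_minus_distrib_mat[of _ k m _ m] mult_smult_distrib[of _ k m _ m])
  have adjE: "mat_adjoint E = E"
    using P by (simp add: E_def mat_adjoint_minus[of _ m m] mat_adjoint_smult adjP)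
  have EE: "E * E = 1\<^sub>m m"
    unfolding EA[OF E] AE[OF P] PP using P by (intro eq_matI) (auto simp: E_def)
  have EV: "E * V = V"
    unfolding EA[OF V(1)] PV using V by (intro eq_matI) auto
  have VE: "mat_adjoint V * E = mat_adjoint V"
    using arg_cong[OF EV, of mat_adjoint] E V by (simp add: mat_adjoint_mult[of _ m m _ n] adjE)
  have EU: "unitary E" "dim_row E = m" using E EE adjE by (auto intro!: unitaryI[of E m])
  define Y where "Y = E * X * E"
  have Y: "Y \<in> carrier_mat m m" using E X by (simp add: Y_def)
  have Y_herm: "hermitian Y"
    using hermitian_congruence[OF X(1) E X(2)] by (simp add: Y_def adjE)
  \<comment> \<open>\<open>E\<close> is its own inverse, so \<open>Y\<close> is similar to
    \<open>X\<close> and its spectrum stays in \<open>I\<close>.\<close>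
  have "similar_mat Y X"
    using E EE X Y by (intro similar_matI[of _ _ E E m]) (auto simp: Y_def)
  then have "spectrum Y = spectrum X"
    using char_poly_similar spectrum_root_char_poly[OF Y] spectrum_root_char_poly[OF X(1)] by metis
  then have Y_spec: "spectrum_in Y I" using X(3) by (simp add: spectrum_in_def)
  have YE: "Y * E = E * X"
    using E X by (simp add: Y_def assoc_mult_mat[of _ m m _ m _ m] EE)
  note fX = mat_fun_carrier[OF X(1,2), of f] and fY = mat_fun_carrier[OF Y Y_herm, of f]
  \<comment> \<open>With \<open>E\<close> as the intertwiner, the functional calculus is seen to
    commute with conjugation by \<open>E\<close>.\<close>
  have "mat_fun f Y * E = E * mat_fun f X"
    by (rule mat_fun_intertwine[OF Y Y_herm X(1,2) E YE])
  then have "mat_fun f Y * E * E = E * mat_fun f X * E" by simp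
  then have fY_eq: "mat_fun f Y = E * mat_fun f X * E"
    using fY E by (simp add: assoc_mult_mat[of _ m m _ m _ m] EE)
  \<comment> \<open>The midpoint has its second weight written \<open>1 - 1/2\<close> to match the
    form of \<open>matrix_convex_on\<close>.\<close>
  define Z where "Z = complex_of_real (1/2) \<cdot>\<^sub>m X + complex_of_real (1 - 1/2) \<cdot>\<^sub>m Y"
  have Z: "Z \<in> carrier_mat m m" using X Y by (simp add: Z_def)
  have Z_herm: "hermitian Z"
    using X Y Y_herm by (simp add: Z_def hermitian_def mat_adjoint_add[of _ m m] mat_adjoint_smult)
  note fZ = mat_fun_carrier[OF Z Z_herm, of f]
  let ?K = "mat_adjoint V * X * V"
  have K: "?K \<in> carrier_mat n n" "hermitian ?K"
    using V V' X hermitian_congruence[OF X(1) V(1) X(2)] by auto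
  \<comment> \<open>\<open>E\<close> fixes \<open>V\<close>, so \<open>Y * V = E * (X * V)\<close>.
    The average of 1 and \<open>E\<close> is the projection \<open>P\<close>, hence
    \<open>Z * V = P * (X * V)\<close>, and \<open>P\<close> factors through
    \<open>V\<close>.\<close>
  have "Z * V = V * ?K"
  proof -
    have "Y * V = E * (X * V)"
      using E X V EV by (simp add: Y_def assoc_mult_mat[of _ m m _ m _ n])
    also have "\<dots> = 2 \<cdot>\<^sub>m (P * (X * V)) - X * V"
      using X V by (intro EA) auto
    finally have YV: "Y * V = 2 \<cdot>\<^sub>m (P * (X * V)) - X * V" .
    have "Z * V = complex_of_real (1/2) \<cdot>\<^sub>m (X * V) + complex_of_real (1 - 1/2) \<cdot>\<^sub>m (Y * V)"
      using X Y V by (simp add: Z_def add_mult_distrib_mat[of _ m m _ _ n] mult_smult_assoc_mat[of _ m m _ n])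
    also have "\<dots> = P * (X * V)"
      unfolding YV using X V P by (intro eq_matI) (auto simp: field_simps)
    also have "\<dots> = V * ?K"
      using X V V' by (simp add: P_def assoc_mult_mat[of _ m n _ m _ n] assoc_mult_mat[of _ n m _ m _ n])
    finally show ?thesis .
  qed
  then have "mat_fun f Z * V = V * mat_fun f ?K"
    by (rule mat_fun_intertwine[OF Z Z_herm K V(1)])
  then have "mat_adjoint V * mat_fun f Z * V = mat_adjoint V * (V * mat_fun f ?K)"
    by (simp add: assoc_mult_mat[OF V' fZ V(1)])
  also have "\<dots> = (mat_adjoint V * V) * mat_fun f ?K"
    by (rule assoc_mult_mat[symmetric, OF V' V(1) mat_fun_carrier[OF K]])
  finally have VfZ: "mat_adjoint V * mat_fun f Z * V = mat_fun f ?K"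
    using V mat_fun_carrier[OF K, of f] by simp
  define S where "S = complex_of_real (1/2) \<cdot>\<^sub>m mat_fun f X + complex_of_real (1 - 1/2) \<cdot>\<^sub>m mat_fun f Y"
  have S: "S \<in> carrier_mat m m" using fX fY by (simp add: S_def)
  \<comment> \<open>\<open>V\<close> absorbs \<open>E\<close> on both sides, so the images of
    \<open>X\<close> and \<open>Y\<close> under \<open>f\<close> have the same compression, and so
    does their average \<open>S\<close>.\<close>
  have VYV: "mat_adjoint V * mat_fun f Y * V = mat_adjoint V * mat_fun f X * V"
  proof -
    have "mat_adjoint V * mat_fun f Y * V = (mat_adjoint V * E) * mat_fun f X * (E * V)"
      unfolding fY_eq using V V' E fX
      by (simp add: assoc_mult_mat[of _ n m _ m _ n] assoc_mult_mat[of _ m m _ m _ n]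
        assoc_mult_mat[of _ n m _ m _ m] assoc_mult_mat[of _ m m _ m _ m])
    then show ?thesis by (simp add: EV VE)
  qed
  have "mat_adjoint V * S * V = complex_of_real (1/2) \<cdot>\<^sub>m (mat_adjoint V * mat_fun f X * V)
      + complex_of_real (1 - 1/2) \<cdot>\<^sub>m (mat_adjoint V * mat_fun f Y * V)"
    using V V' fX fY
    by (simp add: S_def add_mult_distrib_mat[of _ n m _ _ n] mult_add_distrib_mat[of _ n m _ m]
        mult_smult_assoc_mat[of _ n m _ n] mult_smult_distrib[of _ n m _ m])
  then have VSV: "mat_adjoint V * S * V = mat_adjoint V * mat_fun f X * V"
    unfolding VYV by (intro eq_matI) (auto simp: field_simps)
  have "loewner_le (mat_fun f Z) S"
    unfolding Z_def S_def
    by (rule f[unfolded matrix_convex_on_def, rule_format, OF X(1) Y]) (use X Y_herm Y_spec in auto)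
  from loewner_le_congruence[OF fZ S V(1) this] show ?thesis
    by (simp add: VfZ VSV)
qed

section \<open>Direct sums and the two-term Jensen inequality\<close>

lemma hermitian_add:
  assumes "A \<in> carrier_mat n n" "hermitian A" "B \<in> carrier_mat n n" "hermitian B"
  shows "hermitian (A + B)"
  using assms by (simp add: hermitian_def mat_adjoint_add[of _ n n])

text \<open>These are the two coordinate inclusions into a direct sum. With them block arithmetic
  reduces to orthogonality relations, and \<open>mat_fun_intertwine\<close> can be applied to each
  summand.\<close>

lemma block_injections:
  fixes n :: nat
  obtains J\<^sub>1 J\<^sub>2 :: "complex mat" where
    "J\<^sub>1 \<in> carrier_mat (n + n) n" "J\<^sub>2 \<in> carrier_mat (n + n) n"
    "mat_adjoint J\<^sub>1 * J\<^sub>1 = 1\<^sub>m n" "mat_adjoint J\<^sub>2 * J\<^sub>2 = 1\<^sub>m n"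
    "mat_adjoint J\<^sub>1 * J\<^sub>2 = 0\<^sub>m n n" "mat_adjoint J\<^sub>2 * J\<^sub>1 = 0\<^sub>m n n"
    "J\<^sub>1 * mat_adjoint J\<^sub>1 + J\<^sub>2 * mat_adjoint J\<^sub>2 = 1\<^sub>m (n + n)"
proof -
  \<comment> \<open>\<open>J k\<close> embeds into the coordinates from \<open>k\<close> to k + n -
    1; only the shifts 0 and \<open>n\<close> are used.\<close>
  define J where "J k = (mat (n + n) n (\<lambda>(i,j). if i = k + j then 1 else 0) :: complex mat)" for k
  have J: "J k \<in> carrier_mat (n + n) n" for k by (simp add: J_def)
  have [simp]: "dim_row (J k) = n + n" "dim_col (J k) = n" for k by (simp_all add: J_def)
  have JJ: "(mat_adjoint (J k) * J l) $$ (i,j) = (if k + i = l + j then 1 else 0)"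
    if "i < n" "j < n" "k + i < n + n" for k l i j
  proof -
    have "(mat_adjoint (J k) * J l) $$ (i,j) = (\<Sum>r<n+n. cnj (J k $$ (r,i)) * J l $$ (r,j))"
      using that J[of k] J[of l] mat_adjoint_carrier[OF J[of k]]
      by (simp add: scalar_prod_def mat_adjoint_index lessThan_atLeast0)
    also have "\<dots> = (\<Sum>r<n+n. if r = k + i then (if k + i = l + j then 1 else 0) else 0)"
      by (rule sum.cong) (use that in \<open>auto simp: J_def\<close>)
    also have "\<dots> = (if k + i = l + j then 1 else 0)"
      using that by (subst sum.delta) auto
    finally show ?thesis .
  qed
  have JJ': "(J k * mat_adjoint (J k)) $$ (i,j) = (if i = j \<and> k \<le> i \<and> i < k + n then 1 else 0)"
    if "i < n + n" "j < n + n" for k i j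
  proof -
    have "(J k * mat_adjoint (J k)) $$ (i,j) = (\<Sum>r<n. J k $$ (i,r) * cnj (J k $$ (j,r)))"
      using that J[of k] mat_adjoint_carrier[OF J[of k]]
      by (simp add: scalar_prod_def mat_adjoint_index lessThan_atLeast0)
    \<comment> \<open>The subtraction is truncated for i < k, hence the guard
      \<open>k \<le> i\<close>; under it, \<open>r < n\<close> amounts to
      \<open>i < k + n\<close>.\<close>
    also have "\<dots> = (\<Sum>r<n. if r = i - k then (if i = j \<and> k \<le> i then 1 else 0) else 0)"
      by (rule sum.cong) (use that in \<open>auto simp: J_def\<close>)
    also have "\<dots> = (if i = j \<and> k \<le> i \<and> i < k + n then 1 else 0)"
      by (subst sum.delta) auto
    finally show ?thesis .
  qed
  show ?thesis
    by (rule that[of "J 0" "J n"])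
      (use J mat_adjoint_carrier[OF J] in \<open>auto intro!: eq_matI simp: JJ JJ' simp del: index_mult_mat(1)\<close>)
qed

text \<open>The Hansen--Pedersen form of Jensen's operator inequality, as compression of the block diagonal
  matrix with blocks \<open>T\<^sub>1\<close>, \<open>T\<^sub>2\<close> by the isometry with blocks \<open>A\<^sub>1\<close>, \<open>A\<^sub>2\<close>.\<close>
theorem jensen_operator_inequality:
  assumes f: "matrix_convex_on I f"
    and T1: "T\<^sub>1 \<in> carrier_mat n n" "hermitian T\<^sub>1" "spectrum_in T\<^sub>1 I"
    and T2: "T\<^sub>2 \<in> carrier_mat n n" "hermitian T\<^sub>2" "spectrum_in T\<^sub>2 I"
    and A: "A\<^sub>1 \<in> carrier_mat n n" "A\<^sub>2 \<in> carrier_mat n n"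
    and iso: "mat_adjoint A\<^sub>1 * A\<^sub>1 + mat_adjoint A\<^sub>2 * A\<^sub>2 = 1\<^sub>m n"
  shows "loewner_le (mat_fun f (mat_adjoint A\<^sub>1 * T\<^sub>1 * A\<^sub>1 + mat_adjoint A\<^sub>2 * T\<^sub>2 * A\<^sub>2))
    (mat_adjoint A\<^sub>1 * mat_fun f T\<^sub>1 * A\<^sub>1 + mat_adjoint A\<^sub>2 * mat_fun f T\<^sub>2 * A\<^sub>2)"
proof -
  define m where "m = n + n"
  obtain J\<^sub>1 J\<^sub>2 :: "complex mat" where J: "J\<^sub>1 \<in> carrier_mat m n" "J\<^sub>2 \<in> carrier_mat m n"
    and JJ: "mat_adjoint J\<^sub>1 * J\<^sub>1 = 1\<^sub>m n" "mat_adjoint J\<^sub>2 * J\<^sub>2 = 1\<^sub>m n"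
      "mat_adjoint J\<^sub>1 * J\<^sub>2 = 0\<^sub>m n n" "mat_adjoint J\<^sub>2 * J\<^sub>1 = 0\<^sub>m n n"
    and sum1: "J\<^sub>1 * mat_adjoint J\<^sub>1 + J\<^sub>2 * mat_adjoint J\<^sub>2 = 1\<^sub>m m"
    unfolding m_def using block_injections[of n] .
  note A' = mat_adjoint_carrier[OF A(1)] mat_adjoint_carrier[OF A(2)]
  note J' = mat_adjoint_carrier[OF J(1)] mat_adjoint_carrier[OF J(2)]
  note f1 = mat_fun_carrier[OF T1(1,2), of f] and f2 = mat_fun_carrier[OF T2(1,2), of f]
  have JJ_mult: "mat_adjoint J\<^sub>1 * (J\<^sub>1 * B) = B" "mat_adjoint J\<^sub>2 * (J\<^sub>2 * B) = B"
    "mat_adjoint J\<^sub>1 * (J\<^sub>2 * B) = 0\<^sub>m n k" "mat_adjoint J\<^sub>2 * (J\<^sub>1 * B) = 0\<^sub>m n k"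
    if B: "B \<in> carrier_mat n k" for B k
    using assoc_mult_mat[OF J'(1) J(1) B] assoc_mult_mat[OF J'(2) J(2) B]
      assoc_mult_mat[OF J'(1) J(2) B] assoc_mult_mat[OF J'(2) J(1) B] B by (auto simp: JJ)
  \<comment> \<open>\<open>X\<close> is the direct sum of \<open>T\<^sub>1\<close> and
    \<open>T\<^sub>2\<close>, and \<open>V\<close> stacks \<open>A\<^sub>1\<close> on top of
    \<open>A\<^sub>2\<close>.\<close>
  define X where "X = J\<^sub>1 * (T\<^sub>1 * mat_adjoint J\<^sub>1) + J\<^sub>2 * (T\<^sub>2 * mat_adjoint J\<^sub>2)"
  define V where "V = J\<^sub>1 * A\<^sub>1 + J\<^sub>2 * A\<^sub>2"
  have X: "X \<in> carrier_mat m m" using J J' T1 T2 by (auto simp: X_def)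
  have V: "V \<in> carrier_mat m n" using J A by (auto simp: V_def)
  have adjV: "mat_adjoint V = mat_adjoint A\<^sub>1 * mat_adjoint J\<^sub>1 + mat_adjoint A\<^sub>2 * mat_adjoint J\<^sub>2"
    using J A by (simp add: V_def mat_adjoint_add[of _ m n] mat_adjoint_mult[of _ m n _ n])
  have X_herm: "hermitian X"
    using hermitian_congruence[OF T1(1) J'(1) T1(2)] hermitian_congruence[OF T2(1) J'(2) T2(2)] J J' T1 T2
    unfolding X_def by (intro hermitian_add[of _ m]) (auto simp: assoc_mult_mat[of _ m n _ n _ m])
  \<comment> \<open>The mixed terms vanish because the ranges of the two inclusions are
    orthogonal.\<close>
  have adjV_mult: "mat_adjoint V * (J\<^sub>1 * B\<^sub>1 + J\<^sub>2 * B\<^sub>2) = mat_adjoint A\<^sub>1 * B\<^sub>1 + mat_adjoint A\<^sub>2 * B\<^sub>2"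
    if B: "B\<^sub>1 \<in> carrier_mat n n" "B\<^sub>2 \<in> carrier_mat n n" for B\<^sub>1 B\<^sub>2
  proof -
    have C: "J\<^sub>1 * B\<^sub>1 \<in> carrier_mat m n" "J\<^sub>2 * B\<^sub>2 \<in> carrier_mat m n" using J B by auto
    have "mat_adjoint V * (J\<^sub>1 * B\<^sub>1 + J\<^sub>2 * B\<^sub>2)
      = (mat_adjoint A\<^sub>1 * (mat_adjoint J\<^sub>1 * (J\<^sub>1 * B\<^sub>1)) + mat_adjoint A\<^sub>1 * (mat_adjoint J\<^sub>1 * (J\<^sub>2 * B\<^sub>2)))
      + (mat_adjoint A\<^sub>2 * (mat_adjoint J\<^sub>2 * (J\<^sub>1 * B\<^sub>1)) + mat_adjoint A\<^sub>2 * (mat_adjoint J\<^sub>2 * (J\<^sub>2 * B\<^sub>2)))"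
      unfolding adjV using A' J' C
      by (subst add_mult_distrib_mat[of _ n m _ _ n], (auto)[3])
        (simp add: assoc_mult_mat[of _ n n _ m _ n] mult_add_distrib_mat[of _ n m _ n] mult_add_distrib_mat[of _ n n _ n])
    then show ?thesis
      unfolding JJ_mult[OF B(1)] JJ_mult[OF B(2)] using A' B
      by (simp add: right_mult_zero_mat[OF A'(1)] right_mult_zero_mat[OF A'(2)])
  qed
  have XJ: "X * J\<^sub>1 = J\<^sub>1 * T\<^sub>1" "X * J\<^sub>2 = J\<^sub>2 * T\<^sub>2"
    using J J' T1(1) T2(1)
    by (simp_all add: X_def add_mult_distrib_mat[of _ m m _ _ n] assoc_mult_mat[of _ m n _ m _ n]
        assoc_mult_mat[of _ n n _ m _ n] JJ)
  \<comment> \<open>Each inclusion intertwines \<open>X\<close> with one summand, which determines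
    the blocks of \<open>mat_fun f X\<close>.\<close>
  have fXJ: "mat_fun f X * J\<^sub>1 = J\<^sub>1 * mat_fun f T\<^sub>1" "mat_fun f X * J\<^sub>2 = J\<^sub>2 * mat_fun f T\<^sub>2"
    using mat_fun_intertwine[OF X X_herm T1(1,2) J(1) XJ(1)]
      mat_fun_intertwine[OF X X_herm T2(1,2) J(2) XJ(2)] by auto
  have YV: "Y * V = J\<^sub>1 * (S\<^sub>1 * A\<^sub>1) + J\<^sub>2 * (S\<^sub>2 * A\<^sub>2)"
    if Y: "Y \<in> carrier_mat m m" and S: "S\<^sub>1 \<in> carrier_mat n n" "S\<^sub>2 \<in> carrier_mat n n"
      and YJ: "Y * J\<^sub>1 = J\<^sub>1 * S\<^sub>1" "Y * J\<^sub>2 = J\<^sub>2 * S\<^sub>2" for Y S\<^sub>1 S\<^sub>2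
  proof -
    have "Y * V = Y * (J\<^sub>1 * A\<^sub>1) + Y * (J\<^sub>2 * A\<^sub>2)"
      unfolding V_def using Y J A by (intro mult_add_distrib_mat[of _ m m _ n]) auto
    also have "Y * (J\<^sub>1 * A\<^sub>1) = J\<^sub>1 * (S\<^sub>1 * A\<^sub>1)"
      using assoc_mult_mat[OF Y J(1) A(1)] assoc_mult_mat[OF J(1) S(1) A(1)] YJ by simp
    also have "Y * (J\<^sub>2 * A\<^sub>2) = J\<^sub>2 * (S\<^sub>2 * A\<^sub>2)"
      using assoc_mult_mat[OF Y J(2) A(2)] assoc_mult_mat[OF J(2) S(2) A(2)] YJ by simp
    finally show ?thesis .
  qed
  \<comment> \<open>Needed twice: for \<open>X\<close> with blocks \<open>T\<^sub>1\<close>,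
    \<open>T\<^sub>2\<close>, and for \<open>mat_fun f X\<close> with their images.\<close>
  have compress: "mat_adjoint V * Y * V = mat_adjoint A\<^sub>1 * S\<^sub>1 * A\<^sub>1 + mat_adjoint A\<^sub>2 * S\<^sub>2 * A\<^sub>2"
    if Y: "Y \<in> carrier_mat m m" and S: "S\<^sub>1 \<in> carrier_mat n n" "S\<^sub>2 \<in> carrier_mat n n"
      and YJ: "Y * J\<^sub>1 = J\<^sub>1 * S\<^sub>1" "Y * J\<^sub>2 = J\<^sub>2 * S\<^sub>2" for Y S\<^sub>1 S\<^sub>2
  proof -
    have "mat_adjoint V * Y * V = mat_adjoint V * (Y * V)"
      by (rule assoc_mult_mat[OF mat_adjoint_carrier[OF V] Y V])
    also have "\<dots> = mat_adjoint A\<^sub>1 * (S\<^sub>1 * A\<^sub>1) + mat_adjoint A\<^sub>2 * (S\<^sub>2 * A\<^sub>2)"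
      unfolding YV[OF that] using S A by (intro adjV_mult) auto
    finally show ?thesis
      using S A A' by (simp add: assoc_mult_mat[of _ n n _ n _ n])
  qed
  have VV: "mat_adjoint V * V = 1\<^sub>m n"
    using adjV_mult[OF A] iso by (simp flip: V_def)
  \<comment> \<open>By \<open>sum1\<close> the two components of an eigenvector of \<open>X\<close>
    cannot both vanish, and a nonzero component is an eigenvector of its summand for the same
    eigenvalue.\<close>
  have spec: "spectrum_in X I"
    unfolding spectrum_in_def
  proof
    fix z assume "z \<in> spectrum X"
    then obtain v where v: "v \<in> carrier_vec m" "v \<noteq> 0\<^sub>v m" "X *\<^sub>v v = z \<cdot>\<^sub>v v"
      using X by (auto simp: spectrum_def eigenvalue_def eigenvector_def)
    have J'X: "mat_adjoint J\<^sub>1 * X = T\<^sub>1 * mat_adjoint J\<^sub>1" "mat_adjoint J\<^sub>2 * X = T\<^sub>2 * mat_adjoint J\<^sub>2"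
      using arg_cong[OF XJ(1), of mat_adjoint] arg_cong[OF XJ(2), of mat_adjoint] X J T1 T2 X_herm
      by (simp_all add: mat_adjoint_mult[of _ m m _ n] mat_adjoint_mult[of _ m n _ n] hermitian_def)
    have push: "T *\<^sub>v (J *\<^sub>v v) = z \<cdot>\<^sub>v (J *\<^sub>v v)"
      if "J \<in> carrier_mat n m" "T \<in> carrier_mat n n" "J * X = T * J" for J T
    proof -
      have "T *\<^sub>v (J *\<^sub>v v) = J *\<^sub>v (X *\<^sub>v v)"
        using assoc_mult_mat_vec[OF that(1) X v(1)] assoc_mult_mat_vec[OF that(2,1) v(1)] that(3) by simp
      then show ?thesis using v that by (simp add: mult_mat_vec)
    qed
    have "mat_adjoint J\<^sub>1 *\<^sub>v v \<noteq> 0\<^sub>v n \<or> mat_adjoint J\<^sub>2 *\<^sub>v v \<noteq> 0\<^sub>v n"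
    proof (rule ccontr)
      assume "\<not> ?thesis"
      then have 0: "mat_adjoint J\<^sub>1 *\<^sub>v v = 0\<^sub>v n" "mat_adjoint J\<^sub>2 *\<^sub>v v = 0\<^sub>v n" by auto
      have "v = (J\<^sub>1 * mat_adjoint J\<^sub>1 + J\<^sub>2 * mat_adjoint J\<^sub>2) *\<^sub>v v" using v by (simp add: sum1)
      also have "\<dots> = J\<^sub>1 *\<^sub>v (mat_adjoint J\<^sub>1 *\<^sub>v v) + J\<^sub>2 *\<^sub>v (mat_adjoint J\<^sub>2 *\<^sub>v v)"
        using J J' v by (simp add: add_mult_distrib_mat_vec[of _ m m] assoc_mult_mat_vec[of _ m n _ m])
      also have "\<dots> = 0\<^sub>v m" unfolding 0 using J by (intro eq_vecI) auto
      finally show False using v by simp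
    qed
    then have "z \<in> spectrum T\<^sub>1 \<or> z \<in> spectrum T\<^sub>2"
      using push[OF J'(1) T1(1) J'X(1)] push[OF J'(2) T2(1) J'X(2)] J' v T1(1) T2(1)
      by (auto simp: spectrum_def eigenvalue_def eigenvector_def) (metis mult_mat_vec_carrier)+
    then show "z \<in> complex_of_real ` I" using T1(3) T2(3) by (auto simp: spectrum_in_def)
  qed
  show ?thesis
    using matrix_convex_compression[OF f X X_herm spec V VV]
    unfolding compress[OF X T1(1) T2(1) XJ] compress[OF mat_fun_carrier[OF X X_herm] f1 f2 fXJ] .
qed

section \<open>Perspectives\<close>

text \<open>The quadratic form is tested at column \<open>i\<close> of \<open>U\<close>, a unit
  eigenvector with eigenvalue \<open>d i\<close>.\<close>

lemma strictly_pos_real_diag: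
  assumes U: "unitary U" "dim_row U = n" and pos: "strictly_pos (U * real_diag n d * mat_adjoint U)"
    and i: "i < n"
  shows "d i > 0"
proof -
  note c = unitaryD[OF U]
  let ?D = "real_diag n d" and ?e = "unit_vec n i :: complex vec"
  let ?A = "U * ?D * mat_adjoint U"
  have D: "?D \<in> carrier_mat n n" by (rule real_diag_carrier)
  have A: "?A \<in> carrier_mat n n" using c D by auto
  have Ue: "U *\<^sub>v ?e \<in> carrier_vec n" using c by simp
  have U'Ue: "mat_adjoint U *\<^sub>v (U *\<^sub>v ?e) = ?e"
    using assoc_mult_mat_vec[OF c(2,1), of ?e] by (simp add: c(3))
  have "U *\<^sub>v ?e \<noteq> 0\<^sub>v n"
  proof
    assume "U *\<^sub>v ?e = 0\<^sub>v n"
    then have "?e = mat_adjoint U *\<^sub>v 0\<^sub>v n" using U'Ue by simp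
    also have "\<dots> = 0\<^sub>v n" using c by (intro eq_vecI) auto
    finally have "?e $ i = (0\<^sub>v n :: complex vec) $ i" by simp
    then show False using i by simp
  qed
  then have "0 < Re ((?A *\<^sub>v (U *\<^sub>v ?e)) \<bullet>c (U *\<^sub>v ?e))"
    using pos Ue A by (auto simp: strictly_pos_def)
  also have "?A *\<^sub>v (U *\<^sub>v ?e) = U *\<^sub>v (?D *\<^sub>v ?e)"
    using assoc_mult_mat_vec[OF mult_carrier_mat[OF c(1) D] c(2) Ue] assoc_mult_mat_vec[OF c(1) D, of ?e]
    by (simp add: U'Ue)
  also have "(U *\<^sub>v (?D *\<^sub>v ?e)) \<bullet>c (U *\<^sub>v ?e) = (?D *\<^sub>v ?e) \<bullet>c ?e"
    using cscalar_prod_mat_adjoint[OF c(1) _ Ue, of "?D *\<^sub>v ?e"] D by (simp add: U'Ue)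
  also have "?D *\<^sub>v ?e = complex_of_real (d i) \<cdot>\<^sub>v ?e"
    using i by (intro eq_vecI) (auto simp: real_diag_def mat_diag_def)
  also have "(complex_of_real (d i) \<cdot>\<^sub>v ?e) \<bullet>c ?e = complex_of_real (d i)"
    using i by (simp add: unit_vec_def scalar_prod_def if_distrib cong: if_cong)
  finally show ?thesis by simp
qed

text \<open>Both quadratic forms are positive and at least one weight is, so the endpoints 0 and 1
  of \<open>c\<close> are covered.\<close>

lemma strictly_pos_convex:
  assumes "R\<^sub>1 \<in> carrier_mat n n" "strictly_pos R\<^sub>1" "R\<^sub>2 \<in> carrier_mat n n" "strictly_pos R\<^sub>2"
    and c: "0 \<le> c" "c \<le> 1"
  shows "strictly_pos (complex_of_real c \<cdot>\<^sub>m R\<^sub>1 + complex_of_real (1 - c) \<cdot>\<^sub>m R\<^sub>2)"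
  unfolding strictly_pos_def
proof (intro conjI ballI impI)
  let ?R = "complex_of_real c \<cdot>\<^sub>m R\<^sub>1 + complex_of_real (1 - c) \<cdot>\<^sub>m R\<^sub>2"
  show "hermitian ?R"
    using assms by (simp add: strictly_pos_def hermitian_def mat_adjoint_add[of _ n n] mat_adjoint_smult)
  fix v :: "complex vec" assume "v \<in> carrier_vec (dim_row ?R)" "v \<noteq> 0\<^sub>v (dim_row ?R)"
  then have v: "v \<in> carrier_vec n" "v \<noteq> 0\<^sub>v n" using assms by auto
  have smult: "(a \<cdot>\<^sub>m M) *\<^sub>v v = a \<cdot>\<^sub>v (M *\<^sub>v v)" if "M \<in> carrier_mat n n" for a M
    using that v by (intro eq_vecI) auto
  have "(?R *\<^sub>v v) \<bullet>c v = complex_of_real c * ((R\<^sub>1 *\<^sub>v v) \<bullet>c v) + complex_of_real (1 - c) * ((R\<^sub>2 *\<^sub>v v) \<bullet>c v)"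
    using assms v
    by (simp add: add_mult_distrib_mat_vec[of _ n n] add_scalar_prod_distrib[of _ n] smult)
  moreover have "Re ((R\<^sub>1 *\<^sub>v v) \<bullet>c v) > 0" "Re ((R\<^sub>2 *\<^sub>v v) \<bullet>c v) > 0"
    using assms v by (auto simp: strictly_pos_def)
  moreover have "c > 0 \<or> 1 - c > 0" by linarith
  ultimately show "0 < Re ((?R *\<^sub>v v) \<bullet>c v)"
    using c by (auto intro: add_pos_nonneg add_nonneg_pos)
qed

text \<open>In a common eigenbasis of \<open>L\<close> and \<open>R\<close> all matrices involved
  are diagonal, so every identity is one between scalars. \<open>S\<close> is the square root of
  \<open>R\<close> and \<open>Q\<close> its inverse.\<close>

lemma perspective_factorization:
  assumes L: "L \<in> carrier_mat n n" "hermitian L" and R: "R \<in> carrier_mat n n" "strictly_pos R"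
    and comm: "commutator L R = 0\<^sub>m n n"
  obtains S Q where "S \<in> carrier_mat n n" "Q \<in> carrier_mat n n" "hermitian S" "hermitian Q"
    "S * Q = 1\<^sub>m n" "Q * S = 1\<^sub>m n" "S * S = R"
    "mat_quotient L R \<in> carrier_mat n n" "hermitian (mat_quotient L R)"
    "S * mat_quotient L R * S = L"
    "perspective f L R = S * mat_fun f (mat_quotient L R) * S"
proof -
  have LR: "L * R = R * L"
  proof (rule eq_matI)
    fix i j assume "i < dim_row (R * L)" "j < dim_col (R * L)"
    then show "(L * R) $$ (i, j) = (R * L) $$ (i, j)"
      using arg_cong[OF comm, of "\<lambda>M. M $$ (i,j)"] L R by (simp add: commutator_def)
  qed (use L R in auto)
  have "hermitian R" using R by (simp add: strictly_pos_def)
  then obtain U l r where U: "unitary U" "dim_row U = n" and Ld: "L = U * real_diag n l * mat_adjoint U"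
    and Rd: "R = U * real_diag n r * mat_adjoint U"
    using commuting_hermitian_diagonalization[OF L R(1) _ LR] by blast
  have r: "r i > 0" if "i < n" for i
    using strictly_pos_real_diag[OF U _ that] R(2) Rd by simp
  define D where "D d = U * real_diag n d * mat_adjoint U" for d
  have D: "D d \<in> carrier_mat n n" for d
    using unitaryD[OF U] real_diag_carrier[of n d] by (auto simp: D_def)
  have D_herm: "hermitian (D d)" for d
    unfolding D_def by (rule hermitian_conj_real_diag[OF U])
  have DD: "D d * D e = D (\<lambda>i. d i * e i)" for d e
    by (simp add: D_def unitary_conj_mult[OF U real_diag_carrier real_diag_carrier] real_diag_mult)
  \<comment> \<open>Positivity of \<open>r\<close> is known only below \<open>n\<close>, so
    diagonals are compared on these indices alone.\<close>
  have D_cong: "D d = D e" if "\<And>i. i < n \<Longrightarrow> d i = e i" for d e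
  proof -
    have "real_diag n d = real_diag n e"
      using that by (intro eq_matI) (auto simp: real_diag_def mat_diag_def)
    then show ?thesis by (simp add: D_def)
  qed
  have D1: "D d = 1\<^sub>m n" if "\<And>i. i < n \<Longrightarrow> d i = 1" for d
  proof -
    have "D d = D (\<lambda>_. 1)" using that by (rule D_cong)
    then show ?thesis using unitaryD[OF U] by (simp add: D_def real_diag_def)
  qed
  let ?S = "D (\<lambda>i. sqrt (r i))" and ?Q = "D (\<lambda>i. 1 / sqrt (r i))"
  have quot: "mat_quotient L R = D (\<lambda>i. l i / r i)"
  proof -
    let ?R' = "D (\<lambda>i. 1 / r i)"
    have inv: "R * ?R' = 1\<^sub>m n" "?R' * R = 1\<^sub>m n"
      unfolding Rd D_def[symmetric] DD by (rule D1; use r in force)+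
    \<comment> \<open>Invertibility of \<open>R\<close> rules out \<open>None\<close> as the value
      of \<open>mat_inverse\<close>; uniqueness of inverses then identifies the value with
      \<open>?R'\<close>.\<close>
    then have "R \<in> Units (ring_mat TYPE(complex) n ())"
      using R(1) D[of "\<lambda>i. 1 / r i"] by (auto simp: Units_def ring_mat_def)
    then obtain B where B: "mat_inverse R = Some B"
      using mat_inverse(1)[OF R(1), where b = "()"] by (cases "mat_inverse R") auto
    from mat_inverse(2)[OF R(1) this] have "R * B = 1\<^sub>m n" "B * R = 1\<^sub>m n" "B \<in> carrier_mat n n" by auto
    then have "B = ?R' * (R * B)" 
      using assoc_mult_mat[OF D R(1) \<open>B \<in> carrier_mat n n\<close>, of "\<lambda>i. 1 / r i"] inv by simp
    then have "B = ?R'" using \<open>R * B = 1\<^sub>m n\<close> by (simp add: right_mult_one_mat[OF D])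
    then show ?thesis by (simp add: mat_quotient_def B Ld DD flip: D_def)
  qed
  show ?thesis
  proof (rule that)
    show "?S \<in> carrier_mat n n" "?Q \<in> carrier_mat n n" "mat_quotient L R \<in> carrier_mat n n"
      "hermitian ?S" "hermitian ?Q" "hermitian (mat_quotient L R)"
      unfolding quot by (rule D D_herm)+
    show "?S * ?Q = 1\<^sub>m n" "?Q * ?S = 1\<^sub>m n"
      unfolding DD by (rule D1; use r in force)+
    show "?S * ?S = R"
      unfolding DD Rd D_def[symmetric] by (rule D_cong) (use r in \<open>simp add: less_imp_le\<close>)
    show "?S * mat_quotient L R * ?S = L"
      unfolding quot DD unfolding Ld D_def[symmetric]
      by (rule D_cong, drule r) (simp add: field_simps)
    have fquot: "mat_fun f (mat_quotient L R) = D (\<lambda>i. f (l i / r i))"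
      unfolding quot D_def by (rule mat_fun_eq[OF U refl])
    show "perspective f L R = ?S * mat_fun f (mat_quotient L R) * ?S"
      unfolding perspective_def fquot DD unfolding Rd D_def[symmetric] DD
      by (rule D_cong, drule r) (simp add: field_simps)
  qed
qed

section \<open>Joint convexity of the perspective\<close>

theorem theorem2p2:
  fixes I :: "real set" and f :: "real \<Rightarrow> real" and n :: nat and c :: real
    and L\<^sub>1 L\<^sub>2 R\<^sub>1 R\<^sub>2 L R :: "complex mat"
  assumes "is_interval I" and "continuous_on I f" and "matrix_convex_on I f"
    and "0 \<le> c" and "c \<le> 1"
    and "L\<^sub>1 \<in> carrier_mat n n" and "L\<^sub>2 \<in> carrier_mat n n"
    and "R\<^sub>1 \<in> carrier_mat n n" and "R\<^sub>2 \<in> carrier_mat n n"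
    and "strictly_pos L\<^sub>1" and "strictly_pos L\<^sub>2" and "strictly_pos R\<^sub>1" and "strictly_pos R\<^sub>2"
    and "commutator L\<^sub>1 R\<^sub>1 = 0\<^sub>m n n" and "commutator L\<^sub>2 R\<^sub>2 = 0\<^sub>m n n"
    and "spectrum_in (mat_quotient L\<^sub>1 R\<^sub>1) I" and "spectrum_in (mat_quotient L\<^sub>2 R\<^sub>2) I"
    and "L = complex_of_real c \<cdot>\<^sub>m L\<^sub>1 + complex_of_real (1 - c) \<cdot>\<^sub>m L\<^sub>2"
    and "R = complex_of_real c \<cdot>\<^sub>m R\<^sub>1 + complex_of_real (1 - c) \<cdot>\<^sub>m R\<^sub>2"
    and "commutator L R = 0\<^sub>m n n"
  shows "loewner_le (perspective f L R)
    (complex_of_real c \<cdot>\<^sub>m perspective f L\<^sub>1 R\<^sub>1 + complex_of_real (1 - c) \<cdot>\<^sub>m perspective f L\<^sub>2 R\<^sub>2)"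
proof -
  have L: "L \<in> carrier_mat n n" "strictly_pos L" and R: "R \<in> carrier_mat n n" "strictly_pos R"
    using assms(4-13,18,19) strictly_pos_convex[of L\<^sub>1 n L\<^sub>2 c] strictly_pos_convex[of R\<^sub>1 n R\<^sub>2 c] by auto
  have herm: "hermitian L" "hermitian L\<^sub>1" "hermitian L\<^sub>2"
    using L assms(10,11) by (auto simp: strictly_pos_def)
  define T where "T = mat_quotient L R"
  define T\<^sub>1 where "T\<^sub>1 = mat_quotient L\<^sub>1 R\<^sub>1"
  define T\<^sub>2 where "T\<^sub>2 = mat_quotient L\<^sub>2 R\<^sub>2"
  obtain S Q where S: "S \<in> carrier_mat n n" "Q \<in> carrier_mat n n" "hermitian S" "hermitian Q"
    "S * Q = 1\<^sub>m n" "Q * S = 1\<^sub>m n" "S * S = R" "T \<in> carrier_mat n n" "hermitian T"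
    "S * T * S = L" "perspective f L R = S * mat_fun f T * S"
    unfolding T_def by (rule perspective_factorization[OF L(1) herm(1) R assms(20)])
  obtain S\<^sub>1 Q\<^sub>1 where S1: "S\<^sub>1 \<in> carrier_mat n n" "Q\<^sub>1 \<in> carrier_mat n n" "hermitian S\<^sub>1" "hermitian Q\<^sub>1"
    "S\<^sub>1 * Q\<^sub>1 = 1\<^sub>m n" "Q\<^sub>1 * S\<^sub>1 = 1\<^sub>m n" "S\<^sub>1 * S\<^sub>1 = R\<^sub>1" "T\<^sub>1 \<in> carrier_mat n n" "hermitian T\<^sub>1"
    "S\<^sub>1 * T\<^sub>1 * S\<^sub>1 = L\<^sub>1" "perspective f L\<^sub>1 R\<^sub>1 = S\<^sub>1 * mat_fun f T\<^sub>1 * S\<^sub>1"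
    unfolding T\<^sub>1_def by (rule perspective_factorization[OF assms(6) herm(2) assms(8,12,14)])
  obtain S\<^sub>2 Q\<^sub>2 where S2: "S\<^sub>2 \<in> carrier_mat n n" "Q\<^sub>2 \<in> carrier_mat n n" "hermitian S\<^sub>2" "hermitian Q\<^sub>2"
    "S\<^sub>2 * Q\<^sub>2 = 1\<^sub>m n" "Q\<^sub>2 * S\<^sub>2 = 1\<^sub>m n" "S\<^sub>2 * S\<^sub>2 = R\<^sub>2" "T\<^sub>2 \<in> carrier_mat n n" "hermitian T\<^sub>2"
    "S\<^sub>2 * T\<^sub>2 * S\<^sub>2 = L\<^sub>2" "perspective f L\<^sub>2 R\<^sub>2 = S\<^sub>2 * mat_fun f T\<^sub>2 * S\<^sub>2"
    unfolding T\<^sub>2_def by (rule perspective_factorization[OF assms(7) herm(3) assms(9,13,15)])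
  \<comment> \<open>\<open>Q\<close> is the inverse square root of \<open>R\<close>, so
    \<open>A c S\<^sub>1\<close> and \<open>A (1 - c) S\<^sub>2\<close> are the Jensen
    coefficients.\<close>
  define A where "A a X = complex_of_real (sqrt a) \<cdot>\<^sub>m (X * Q)" for a and X :: "complex mat"
  have A: "A a X \<in> carrier_mat n n" if "X \<in> carrier_mat n n" for a X
    using that S by (simp add: A_def)
  have AYA: "mat_adjoint (A a X) * Y * A a X = Q * (complex_of_real a \<cdot>\<^sub>m (X * Y * X)) * Q"
    if "0 \<le> a" "X \<in> carrier_mat n n" "hermitian X" "Y \<in> carrier_mat n n" for a X Y
  proof -
    have adj: "mat_adjoint (A a X) = complex_of_real (sqrt a) \<cdot>\<^sub>m (Q * X)"
      using that S by (simp add: A_def mat_adjoint_smult mat_adjoint_mult[of _ n n _ n] hermitian_def)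
    have "mat_adjoint (A a X) * Y * A a X
        = complex_of_real (sqrt a) \<cdot>\<^sub>m (complex_of_real (sqrt a) \<cdot>\<^sub>m (Q * (X * Y * X) * Q))"
      unfolding adj unfolding A_def using that S
      by (simp add: mult_smult_distrib[of _ n n _ n] mult_smult_assoc_mat[of _ n n _ n]
          assoc_mult_mat[of _ n n _ n _ n])
    also have "\<dots> = complex_of_real a \<cdot>\<^sub>m (Q * (X * Y * X) * Q)"
      using that by (intro eq_matI) (auto simp flip: of_real_mult mult.assoc)
    finally show ?thesis
      using that S by (simp add: mult_smult_distrib[of _ n n _ n] mult_smult_assoc_mat[of _ n n _ n])
  qed
  have sum_conj: "Z * B * Z + Z * C * Z = Z * (B + C) * Z"
    if "Z \<in> carrier_mat n n" "B \<in> carrier_mat n n" "C \<in> carrier_mat n n" for Z B C :: "complex mat"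
    using that by (simp add: add_mult_distrib_mat[of _ n n _ _ n] mult_add_distrib_mat[of _ n n _ n])
  have c': "0 \<le> 1 - c" using assms(5) by simp
  \<comment> \<open>One identity for three choices of the inner matrices: the unit matrix gives
    \<open>iso\<close>, the quotients give \<open>quot\<close>, and their images under
    \<open>f\<close> give the upper bound.\<close>
  have combine: "mat_adjoint (A c S\<^sub>1) * Y\<^sub>1 * A c S\<^sub>1 + mat_adjoint (A (1 - c) S\<^sub>2) * Y\<^sub>2 * A (1 - c) S\<^sub>2
      = Q * (complex_of_real c \<cdot>\<^sub>m (S\<^sub>1 * Y\<^sub>1 * S\<^sub>1) + complex_of_real (1 - c) \<cdot>\<^sub>m (S\<^sub>2 * Y\<^sub>2 * S\<^sub>2)) * Q"
    if Y: "Y\<^sub>1 \<in> carrier_mat n n" "Y\<^sub>2 \<in> carrier_mat n n" for Y\<^sub>1 Y\<^sub>2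
    unfolding AYA[OF assms(4) S1(1,3) Y(1)] AYA[OF c' S2(1,3) Y(2)]
    using S(2) S1(1) S2(1) Y by (intro sum_conj) auto
  have unsandwich: "Z * (Z' * B * Z') * Z = B"
    if "Z \<in> carrier_mat n n" "Z' \<in> carrier_mat n n" "B \<in> carrier_mat n n" "Z * Z' = 1\<^sub>m n" "Z' * Z = 1\<^sub>m n"
    for Z Z' B :: "complex mat"
  proof -
    have "Z * (Z' * B * Z') * Z = (Z * Z') * B * (Z' * Z)"
      using that(1-3) by (simp add: assoc_mult_mat[of _ n n _ n _ n])
    then show ?thesis using that by simp
  qed
  have "mat_adjoint (A c S\<^sub>1) * A c S\<^sub>1 + mat_adjoint (A (1 - c) S\<^sub>2) * A (1 - c) S\<^sub>2 = Q * R * Q"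
    using combine[of "1\<^sub>m n" "1\<^sub>m n"] A[OF S1(1), of c] A[OF S2(1), of "1 - c"] S1 S2
      mat_adjoint_carrier[OF A[OF S1(1)], of c] mat_adjoint_carrier[OF A[OF S2(1)], of "1 - c"]
    by (simp add: assms(19))
  also have "Q * R * Q = 1\<^sub>m n"
    using unsandwich[OF S(2,1) one_carrier_mat S(6,5)] S by simp
  finally have iso: "mat_adjoint (A c S\<^sub>1) * A c S\<^sub>1 + mat_adjoint (A (1 - c) S\<^sub>2) * A (1 - c) S\<^sub>2 = 1\<^sub>m n" .
  \<comment> \<open>The square roots turn the quotients back into \<open>L\<^sub>1\<close> and
    \<open>L\<^sub>2\<close>, whose combination is \<open>L\<close>; then \<open>Q * L * Q\<close>
    is \<open>T\<close>.\<close>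
  have quot: "mat_adjoint (A c S\<^sub>1) * T\<^sub>1 * A c S\<^sub>1 + mat_adjoint (A (1 - c) S\<^sub>2) * T\<^sub>2 * A (1 - c) S\<^sub>2 = T"
    unfolding combine[OF S1(8) S2(8)] S1(10) S2(10) assms(18)[symmetric]
    using unsandwich[OF S(2,1,8,6,5)] by (simp only: S(10))
  note fT = mat_fun_carrier[OF S(8,9), of f]
    and f1 = mat_fun_carrier[OF S1(8,9), of f] and f2 = mat_fun_carrier[OF S2(8,9), of f]
  let ?P = "complex_of_real c \<cdot>\<^sub>m perspective f L\<^sub>1 R\<^sub>1 + complex_of_real (1 - c) \<cdot>\<^sub>m perspective f L\<^sub>2 R\<^sub>2"
  have P: "?P \<in> carrier_mat n n" using S1 S2 f1 f2 by simp
  have "loewner_le (mat_fun f T) (Q * ?P * Q)"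
    using jensen_operator_inequality[OF assms(3) S1(8,9) _ S2(8,9) _ A[OF S1(1)] A[OF S2(1)] iso]
      assms(16,17) unfolding quot combine[OF f1 f2] S1(11) S2(11) by (simp add: T\<^sub>1_def T\<^sub>2_def)
  \<comment> \<open>Conjugation by \<open>S\<close> turns the left side into the perspective and
    cancels both factors \<open>Q\<close> on the right.\<close>
  from loewner_le_congruence[OF fT _ S(1) this]
  have "loewner_le (S * mat_fun f T * S) (S * (Q * ?P * Q) * S)"
    using S P by (auto simp: hermitian_def)
  then show ?thesis
    by (simp only: unsandwich[OF S(1,2) P S(5,6)] S(11))
qed

end
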